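(* Let $\xi<\omega_1$. For every infinite $M\subset\mathbb N$ the closed subspace of $X_{G_\xi}$ spanned by $(e_n)_{n\in M}$ has Bourgain $\ell_1$-index greater than $\omega^\xi$.
   Context: General notation. $\mathbb N=\{1,2,\dots\}$, $(e_n)$ is the unit vector basis of $c_{00}(\mathbb N)$, $e_n^*$ the coordinate functionals; an element $f\in c_{00}(\mathbb N)$ acts on $c_{00}(\mathbb N)$ by $f(x)=\sum_n f(n)x(n)$. For an interval $E\subset\mathbb N$, $Ef$ is the restriction of $f$ to $E$. $f<g$ means $\max\operatorname{supp}f<\min\operatorname{supp}g$. Schreier families. $\mathcal S_0=\{\{n\}:n\in\mathbb N\}\cup\{\emptyset\}$; $\mathcal S_{\xi+1}=\{F_1\cup\dots\cup F_m: m\in\mathbb N,\ F_i\in\mathcal S_\xi,\ m\le F_1<\dots<F_m\}$; for limit $\xi<\omega_1$ fix $\xi_n\nearrow\xi$ and set $\mathcal S_\xi=\{F: F\in\mathcal S_{\xi_n}\text{ and }n\le F\text{ for some }n\}$. The set $G_\xi$. Fix $\xi<\omega_1$. Let $m_1=2^5$, $m_{j+1}=m_j^5$, $n_1=2^6$, $n_{j+1}=(2n_j)^{s_j}$ where $2^{s_j}=m_{j+1}^3$. Put $G_0=\{\pm e_n^*:n\in\mathbb N\}$ and, for $j\in\mathbb N$, $G_1^j=\{m_{2j-1}^{-2}\sum_{i\in B}\varepsilon_ie_i^*: B\subset\mathbb N,\ 1\le\#B\le n_{2j-1},\ \varepsilon_i\in\{-1,1\}\}$, $G_1=\bigcup_jG_1^j$;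 for $f\in G_1^j$ put $\operatorname{ind}(f)=j$. Let $\mathcal U$ be the set of finite sequences $(f_1,\dots,f_d)$ with $f_1<\dots<f_d$, $f_i\in G_1^{j_i}$, $j_1<\dots<j_d$. Fix a partition $\mathbb N=M_1\cup M_2$ into infinite disjoint sets and an injective map $\sigma_1:\mathcal U\to M_2$ with $\sigma_1(f_1,\dots,f_{i+1})>\sigma_1(f_1,\dots,f_i)$ always. A special sequence is $(f_1,\dots,f_d)\in\mathcal U$ such that $\{\min\operatorname{supp}f_i:i\le d\}\in\mathcal S_\xi$, $f_1\in G_1^{j_1}$ with $j_1\in M_1$, and $f_{i+1}\in G_1^{\sigma_1(f_1,\dots,f_i)}$ for $1\le i<d$. Put $G_{sp}=\{E\sum_{i=1}^d\varepsilon_if_i:(f_1,\dots,f_d)\text{ special},\ \varepsilon_i\in\{-1,1\},\ E\text{ an interval}\}$, and for $\phi=E\sum\varepsilon_if_i\in G_{sp}$ put $\operatorname{ind}(\phi)=\{\operatorname{ind}(f_i):Ef_i\neq0\}$ (for $\phi\in G_1^j$, $\operatorname{ind}(\phi)$ is identified with $\{j\}$). Put $G_{\ell_2}=\{\sum_{i=1}^da_i\phi_i: d\in\mathbb N,\ a_i\in\mathbb Q,\ \sum a_i^2\le1,\ \phi_i\in G_{sp}\cup G_1,\ (\operatorname{ind}\phi_i)_{i=1}^d\text{ pairwise disjoint}\}$ and $G_\xi=G_0\cup G_1\cup G_{sp}\cup G_{\ell_2}$. Finally $\|x\|_{G_\xi}=\sup\{\phi(x):\phi\in G_\xi\}$ for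 $x\in c_{00}(\mathbb N)$ and $X_{G_\xi}$ is the completion of $(c_{00}(\mathbb N),\|\cdot\|_{G_\xi})$. Bourgain index. A tree on a set $X$ is a set $\mathcal{T}\subset\bigcup_{n\ge 1}X^n$ closed under nonempty initial segments. $D(\mathcal{T})=\{(x_1,\dots,x_k): (x_1,\dots,x_k,x)\in\mathcal{T}\text{ for some }x\}$, $D^0(\mathcal T)=\mathcal T$, $D^{\alpha+1}(\mathcal T)=D(D^\alpha(\mathcal T))$, $D^\alpha(\mathcal T)=\bigcap_{\beta<\alpha}D^\beta(\mathcal T)$ for limit $\alpha$; $o(\mathcal T)=\inf\{\alpha: D^\alpha(\mathcal T)=\emptyset\}$ for well-founded $\mathcal T$. An $\ell_1$-tree on a Banach space with constant $C\ge1$ is a tree each of whose elements $(x_1,\dots,x_k)$ is a normalized sequence $C$-equivalent to the unit vector basis of $\ell_1^k$. The Bourgain $\ell_1$-index of a (separable, not containing $\ell_1$) Banach space is the supremum of $o(\mathcal T)$ over all $\ell_1$-trees on it, with any constants $C\ge1$. *)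

theory Defs
  imports "HOL-Analysis.Analysis"
begin

section \<open>Countable ordinals\<close>

text \<open>
  The type below consists of the ordinals \<open>\<le> \<omega>\<^sub>1\<close>: \<^term>\<open>cardSuc natLeq\<close> is a
  well-order of type \<open>\<omega>\<^sub>1\<close>, and \<^term>\<open>None\<close> is put on top of it.  So \<open>top\<close> plays the role of
  \<open>\<omega>\<^sub>1\<close>, the countable ordinals are exactly the elements \<open>< top\<close>
  (lemma \<open>less_top_iff_countable\<close>), and \<open>bot\<close> is the ordinal \<open>0\<close>.
\<close>

typedef ordw1 = "insert None (Some ` Field (cardSuc natLeq))"
  by blast

instantiation ordw1 :: linorder
begin

definition less_eq_ordw1 :: "ordw1 \<Rightarrow> ordw1 \<Rightarrow> bool" where
  "x \<le> y \<longleftrightarrow> (case Rep_ordw1 y of None \<Rightarrow> True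
      | Some b \<Rightarrow> (case Rep_ordw1 x of None \<Rightarrow> False | Some a \<Rightarrow> (a, b) \<in> cardSuc natLeq))"

definition less_ordw1 :: "ordw1 \<Rightarrow> ordw1 \<Rightarrow> bool" where
  "x < y \<longleftrightarrow> x \<le> y \<and> \<not> y \<le> (x :: ordw1)"

lemma Well_order_w1: "Well_order (cardSuc natLeq)"
  using cardSuc_Card_order[OF natLeq_Card_order] by (simp add: card_order_on_def)

instance
proof
  note wo = Well_order_w1[unfolded well_order_on_def linear_order_on_def
      partial_order_on_def preorder_on_def]
  have R: "refl_on (Field (cardSuc natLeq)) (cardSuc natLeq)" and
    T: "trans (cardSuc natLeq)" and A: "antisym (cardSuc natLeq)" and
    L: "total_on (Field (cardSuc natLeq)) (cardSuc natLeq)"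
    using wo by blast+
  fix x y z :: ordw1
  have rep: "Rep_ordw1 u = None \<or> (\<exists>a \<in> Field (cardSuc natLeq). Rep_ordw1 u = Some a)" for u
    using Rep_ordw1[of u] by auto
  show "x < y \<longleftrightarrow> x \<le> y \<and> \<not> y \<le> x" by (rule less_ordw1_def)
  show "x \<le> x"
    using rep[of x] R by (auto simp: less_eq_ordw1_def refl_on_def)
  show "x \<le> z" if "x \<le> y" "y \<le> z"
    using that T unfolding less_eq_ordw1_def
    by (auto split: option.splits dest: transD)
  show "x = y" if "x \<le> y" "y \<le> x"
  proof -
    have "Rep_ordw1 x = Rep_ordw1 y"
      using that A unfolding less_eq_ordw1_def
      by (auto split: option.splits dest: antisymD)
    then show ?thesis by (simp add: Rep_ordw1_inject)
  qed
  show "x \<le> y \<or> y \<le> x"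
    using rep[of x] rep[of y] R L unfolding less_eq_ordw1_def
    by (auto split: option.splits simp: total_on_def refl_on_def) metis
qed

end

instance ordw1 :: wellorder
proof
  fix P :: "ordw1 \<Rightarrow> bool" and x :: ordw1
  assume step: "\<And>x. (\<And>y. y < x \<Longrightarrow> P y) \<Longrightarrow> P x"
  have wf: "wf (cardSuc natLeq - Id)"
    using Well_order_w1 by (simp add: well_order_on_def)
  have some: "Rep_ordw1 x = Some a \<Longrightarrow> P x" for a x
  proof (induction a arbitrary: x rule: wf_induct_rule[OF wf])
    case (1 a)
    show ?case
    proof (rule step)
      fix y assume y: "y < x"
      then obtain b where b: "Rep_ordw1 y = Some b" "(b, a) \<in> cardSuc natLeq"
        using 1(2) by (auto simp: less_ordw1_def less_eq_ordw1_def split: option.splits)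
      have "b \<noteq> a"
        using y b 1(2) by (metis Rep_ordw1_inject less_irrefl)
      then show "P y" using 1(1) b by blast
    qed
  qed
  show "P x"
  proof (cases "Rep_ordw1 x")
    case None
    show ?thesis
    proof (rule step)
      fix y assume "y < x"
      then have "Rep_ordw1 y \<noteq> None"
        using None by (auto simp: less_ordw1_def less_eq_ordw1_def split: option.splits)
      then show "P y" using some by blast
    qed
  qed (rule some)
qed

lemma le_Abs_None: "x \<le> Abs_ordw1 None"
  by (simp add: less_eq_ordw1_def Abs_ordw1_inverse)

instantiation ordw1 :: complete_linorder
begin

definition top_ordw1 :: ordw1 where "top = Abs_ordw1 None"
definition bot_ordw1 :: ordw1 where "bot = (LEAST x :: ordw1. True)"
definition inf_ordw1 :: "ordw1 \<Rightarrow> ordw1 \<Rightarrow> ordw1" where "inf (x :: ordw1) y = min x y"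
definition sup_ordw1 :: "ordw1 \<Rightarrow> ordw1 \<Rightarrow> ordw1" where "sup (x :: ordw1) y = max x y"
definition Inf_ordw1 :: "ordw1 set \<Rightarrow> ordw1" where
  "Inf A = (LEAST x :: ordw1. x \<in> insert top A)"
definition Sup_ordw1 :: "ordw1 set \<Rightarrow> ordw1" where
  "Sup A = (LEAST x :: ordw1. \<forall>a\<in>A. a \<le> x)"

instance
proof
  have top: "x \<le> top" for x :: ordw1 by (simp add: top_ordw1_def le_Abs_None)
  have bot: "bot \<le> x" for x :: ordw1 by (simp add: bot_ordw1_def Least_le)
  fix x y z :: ordw1 and A :: "ordw1 set"
  show "Inf A \<le> x" if "x \<in> A"
    using that by (simp add: Inf_ordw1_def Least_le)
  show "z \<le> Inf A" if "\<And>x. x \<in> A \<Longrightarrow> z \<le> x"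
  proof -
    have "Inf A \<in> insert top A"
      unfolding Inf_ordw1_def by (rule LeastI[of "\<lambda>x. x \<in> insert top A" top]) simp
    then show ?thesis using that top by auto
  qed
  have ub: "\<forall>a\<in>A. a \<le> Sup A"
    unfolding Sup_ordw1_def by (rule LeastI[of "\<lambda>x. \<forall>a\<in>A. a \<le> x" top]) (use top in blast)
  show "x \<le> Sup A" if "x \<in> A" using ub that by blast
  show "Sup A \<le> z" if "\<And>x. x \<in> A \<Longrightarrow> x \<le> z"
    using that by (simp add: Sup_ordw1_def Least_le)
  show "Inf {} = (top :: ordw1)"
    unfolding Inf_ordw1_def by (rule Least_equality) auto
  show "Sup {} = (bot :: ordw1)"
    by (simp add: Sup_ordw1_def bot_ordw1_def)
qed (auto simp: inf_ordw1_def sup_ordw1_def)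

end

lemma countable_iff_natLeq:
  includes cardinal_syntax
  shows "countable A \<longleftrightarrow> |A| \<le>o natLeq"
proof -
  have "countable A \<longleftrightarrow> |A| \<le>o |UNIV :: nat set|"
    unfolding countable_def card_of_ordLeq[symmetric] by auto
  also have "\<dots> \<longleftrightarrow> |A| \<le>o natLeq"
    using ordLeq_ordIso_trans[OF _ card_of_nat]
      ordLeq_ordIso_trans[OF _ ordIso_symmetric[OF card_of_nat]] by (rule iffI)
  finally show ?thesis .
qed

lemma less_top_iff_countable:
  includes cardinal_syntax
  shows "(\<xi> :: ordw1) < top \<longleftrightarrow> countable {..<\<xi>}"
proof -
  let ?r = "cardSuc natLeq"
  have co: "Card_order ?r" by (rule cardSuc_Card_order[OF natLeq_Card_order])
  have inj: "inj_on Rep_ordw1 S" for S by (simp add: inj_on_def Rep_ordw1_inject)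
  show ?thesis
  proof
    assume "\<xi> < top"
    then have "Rep_ordw1 \<xi> \<noteq> None"
      by (metis Rep_ordw1_inverse less_irrefl top_ordw1_def)
    then obtain a where a: "Rep_ordw1 \<xi> = Some a" "a \<in> Field ?r"
      using Rep_ordw1[of \<xi>] by auto
    have "|underS ?r a| <o ?r" by (rule card_of_underS[OF co a(2)])
    then have "|underS ?r a| \<le>o natLeq"
      by (rule cardSuc_ordLeq_ordLess[OF natLeq_Card_order card_of_Card_order, THEN iffD1])
    then have "countable (underS ?r a)"
      by (simp add: countable_iff_natLeq)
    moreover have "Rep_ordw1 ` {..<\<xi>} \<subseteq> Some ` underS ?r a"
    proof
      fix u assume "u \<in> Rep_ordw1 ` {..<\<xi>}"
      then obtain y where y: "y < \<xi>" "u = Rep_ordw1 y" by auto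
      then obtain b where b: "Rep_ordw1 y = Some b" "(b, a) \<in> ?r"
        using a by (auto simp: less_ordw1_def less_eq_ordw1_def split: option.splits)
      have "b \<noteq> a" using y b a by (metis Rep_ordw1_inject less_irrefl)
      then show "u \<in> Some ` underS ?r a" using b y by (auto simp: underS_def)
    qed
    ultimately have "countable (Rep_ordw1 ` {..<\<xi>})"
      using countable_subset countable_image by metis
    then show "countable {..<\<xi>}" using inj by (rule countable_image_inj_on)
  next
    assume c: "countable {..<\<xi>}"
    have "\<not> countable {..<top :: ordw1}"
    proof
      assume "countable {..<top :: ordw1}"
      moreover have "Some ` Field ?r \<subseteq> Rep_ordw1 ` {..<top}"
      proof
        fix u assume u: "u \<in> Some ` Field ?r"
        then have rep: "Rep_ordw1 (Abs_ordw1 u) = u" by (intro Abs_ordw1_inverse) auto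
        then have "Abs_ordw1 u \<noteq> top"
          using u by (auto simp: top_ordw1_def Abs_ordw1_inject)
        then have "Abs_ordw1 u < top" using top.not_eq_extremum by blast
        then show "u \<in> Rep_ordw1 ` {..<top}" using rep by force
      qed
      ultimately have "countable (Some ` Field ?r)"
        using countable_subset countable_image by metis
      then have "countable (Field ?r)" by (rule countable_image_inj_on) simp
      then have "|Field ?r| \<le>o natLeq"
        by (simp add: countable_iff_natLeq)
      then have "?r \<le>o natLeq"
        by (rule ordIso_ordLeq_trans[OF ordIso_symmetric[OF card_of_Field_ordIso[OF co]]])
      then show False
        using not_ordLess_ordLeq[OF cardSuc_greater[OF natLeq_Card_order]] by contradiction
    qed
    then show "\<xi> < top" using c top.not_eq_extremum by blast
  qed
qed

subsection \<open>Transfinite recursion and ordinal arithmetic\<close>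

definition osuc :: "ordw1 \<Rightarrow> ordw1" where
  "osuc \<alpha> = Inf {\<beta>. \<alpha> < \<beta>}"

definition is_limit :: "ordw1 \<Rightarrow> bool" where
  "is_limit \<alpha> \<longleftrightarrow> \<alpha> \<noteq> bot \<and> \<not> (\<exists>\<beta><\<alpha>. \<alpha> = osuc \<beta>)"

text \<open>
  Recursion with value \<open>z\<close> at \<open>0\<close>, value \<open>s r\<close> at \<open>\<beta> + 1\<close> if \<open>r\<close> is the value at \<open>\<beta>\<close>, and
  value \<open>l \<alpha> f\<close> at limits \<open>\<alpha>\<close>, where \<open>f\<close> is the function defined so far (only its values
  below \<open>\<alpha>\<close> are meaningful); see the equations \<open>ord_rec_bot\<close>, \<open>ord_rec_osuc\<close>, \<open>ord_rec_limit\<close>.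
\<close>
definition ord_rec :: "'b \<Rightarrow> ('b \<Rightarrow> 'b) \<Rightarrow> (ordw1 \<Rightarrow> (ordw1 \<Rightarrow> 'b) \<Rightarrow> 'b) \<Rightarrow> ordw1 \<Rightarrow> 'b" where
  "ord_rec z s l = wfrec {(\<beta>, \<alpha>). \<beta> < \<alpha>} (\<lambda>f \<alpha>.
     if \<alpha> = bot then z
     else if is_limit \<alpha> then l \<alpha> f
     else s (f (THE \<beta>. \<beta> < \<alpha> \<and> \<alpha> = osuc \<beta>)))"

lemma osuc_greater: "\<alpha> < top \<Longrightarrow> \<alpha> < osuc \<alpha>"
proof -
  assume "\<alpha> < top"
  then have "osuc \<alpha> = (LEAST \<beta>. \<alpha> < \<beta>)"
    unfolding osuc_def
    by (intro antisym Inf_lower Inf_greatest) (auto intro: LeastI Least_le)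
  with \<open>\<alpha> < top\<close> show ?thesis by (metis LeastI)
qed

lemma osuc_le: "\<alpha> < \<beta> \<Longrightarrow> osuc \<alpha> \<le> \<beta>"
  by (simp add: osuc_def Inf_lower)

lemma osuc_inject: "osuc \<alpha> = osuc \<beta> \<Longrightarrow> \<alpha> < top \<Longrightarrow> \<beta> < top \<Longrightarrow> \<alpha> = \<beta>"
  by (metis linorder_neqE not_less osuc_greater osuc_le)

lemma osuc_less_top: "\<alpha> < top \<Longrightarrow> osuc \<alpha> < top"
proof -
  assume "\<alpha> < top"
  moreover have "{..<osuc \<alpha>} \<subseteq> insert \<alpha> {..<\<alpha>}"
  proof
    fix \<beta> assume "\<beta> \<in> {..<osuc \<alpha>}"
    then have "\<not> \<alpha> < \<beta>" using osuc_le[of \<alpha> \<beta>] by auto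
    then show "\<beta> \<in> insert \<alpha> {..<\<alpha>}" by auto
  qed
  ultimately show ?thesis
    by (metis countable_insert countable_subset less_top_iff_countable)
qed

lemma ord_rec_unfold:
  "ord_rec z s l \<alpha> =
     (if \<alpha> = bot then z
      else if is_limit \<alpha> then l \<alpha> (cut (ord_rec z s l) {(\<beta>, \<alpha>). \<beta> < \<alpha>} \<alpha>)
      else s (cut (ord_rec z s l) {(\<beta>, \<alpha>). \<beta> < \<alpha>} \<alpha> (THE \<beta>. \<beta> < \<alpha> \<and> \<alpha> = osuc \<beta>)))"
  unfolding ord_rec_def by (subst wfrec[OF wellorder_class.wf]) simp

lemma ord_rec_bot: "ord_rec z s l bot = z"
  by (simp add: ord_rec_unfold)

lemma ord_rec_osuc:
  assumes "\<beta> < top"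
  shows "ord_rec z s l (osuc \<beta>) = s (ord_rec z s l \<beta>)"
proof -
  have lt: "\<beta> < osuc \<beta>" using assms by (rule osuc_greater)
  have "(THE \<gamma>. \<gamma> < osuc \<beta> \<and> osuc \<beta> = osuc \<gamma>) = \<beta>"
    by (rule the_equality)
      (use lt assms in \<open>auto intro: osuc_inject less_le_trans[OF _ top_greatest]\<close>)
  moreover have "osuc \<beta> \<noteq> bot" "\<not> is_limit (osuc \<beta>)"
    using lt by (auto simp: is_limit_def)
  ultimately show ?thesis
    using lt by (subst ord_rec_unfold) (simp add: cut_apply)
qed

lemma ord_rec_limit:
  assumes "is_limit \<alpha>" and "\<And>f g. (\<And>\<beta>. \<beta> < \<alpha> \<Longrightarrow> f \<beta> = g \<beta>) \<Longrightarrow> l \<alpha> f = l \<alpha> g"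
  shows "ord_rec z s l \<alpha> = l \<alpha> (ord_rec z s l)"
proof -
  have "\<alpha> \<noteq> bot" using assms(1) by (simp add: is_limit_def)
  then have "ord_rec z s l \<alpha> = l \<alpha> (cut (ord_rec z s l) {(\<beta>, \<alpha>). \<beta> < \<alpha>} \<alpha>)"
    using assms(1) by (simp only: ord_rec_unfold[of z s l \<alpha>] if_True if_False)
  also have "\<dots> = l \<alpha> (ord_rec z s l)"
    by (rule assms(2)) (simp add: cut_apply)
  finally show ?thesis .
qed

lemma ord_rec_SUP:
  fixes z :: "'b::complete_lattice"
  assumes "is_limit \<alpha>"
  shows "ord_rec z s (\<lambda>\<beta> f. SUP \<gamma>\<in>{..<\<beta>}. f \<gamma>) \<alpha> =
    (SUP \<beta>\<in>{..<\<alpha>}. ord_rec z s (\<lambda>\<beta> f. SUP \<gamma>\<in>{..<\<beta>}. f \<gamma>) \<beta>)"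
  using assms by (rule ord_rec_limit) (rule SUP_cong, simp_all)

definition ord_add :: "ordw1 \<Rightarrow> ordw1 \<Rightarrow> ordw1" where
  "ord_add \<alpha> = ord_rec \<alpha> osuc (\<lambda>\<beta> f. SUP \<gamma>\<in>{..<\<beta>}. f \<gamma>)"

definition ord_mult :: "ordw1 \<Rightarrow> ordw1 \<Rightarrow> ordw1" where
  "ord_mult \<alpha> = ord_rec bot (\<lambda>r. ord_add r \<alpha>) (\<lambda>\<beta> f. SUP \<gamma>\<in>{..<\<beta>}. f \<gamma>)"

definition ord_power :: "ordw1 \<Rightarrow> ordw1 \<Rightarrow> ordw1" where
  "ord_power \<alpha> = ord_rec (osuc bot) (\<lambda>r. ord_mult r \<alpha>) (\<lambda>\<beta> f. SUP \<gamma>\<in>{..<\<beta>}. f \<gamma>)"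

lemma ord_add_bot: "ord_add \<alpha> bot = \<alpha>"
  by (simp only: ord_add_def ord_rec_bot)

lemma ord_add_osuc: "\<beta> < top \<Longrightarrow> ord_add \<alpha> (osuc \<beta>) = osuc (ord_add \<alpha> \<beta>)"
  by (simp only: ord_add_def ord_rec_osuc)

lemma ord_add_limit: "is_limit \<beta> \<Longrightarrow> ord_add \<alpha> \<beta> = (SUP \<gamma>\<in>{..<\<beta>}. ord_add \<alpha> \<gamma>)"
  unfolding ord_add_def by (rule ord_rec_SUP)

lemma ord_mult_bot: "ord_mult \<alpha> bot = bot"
  by (simp only: ord_mult_def ord_rec_bot)

lemma ord_mult_osuc: "\<beta> < top \<Longrightarrow> ord_mult \<alpha> (osuc \<beta>) = ord_add (ord_mult \<alpha> \<beta>) \<alpha>"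
  by (simp only: ord_mult_def ord_rec_osuc)

lemma ord_mult_limit: "is_limit \<beta> \<Longrightarrow> ord_mult \<alpha> \<beta> = (SUP \<gamma>\<in>{..<\<beta>}. ord_mult \<alpha> \<gamma>)"
  unfolding ord_mult_def by (rule ord_rec_SUP)

lemma ord_power_bot: "ord_power \<alpha> bot = osuc bot"
  by (simp only: ord_power_def ord_rec_bot)

lemma ord_power_osuc: "\<beta> < top \<Longrightarrow> ord_power \<alpha> (osuc \<beta>) = ord_mult (ord_power \<alpha> \<beta>) \<alpha>"
  by (simp only: ord_power_def ord_rec_osuc)

lemma ord_power_limit: "is_limit \<beta> \<Longrightarrow> ord_power \<alpha> \<beta> = (SUP \<gamma>\<in>{..<\<beta>}. ord_power \<alpha> \<gamma>)"
  unfolding ord_power_def by (rule ord_rec_SUP)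

definition ord_omega :: ordw1 where
  "ord_omega = (SUP n. (osuc ^^ n) bot)"

section \<open>Trees and the Bourgain index\<close>

definition is_tree :: "'a list set \<Rightarrow> bool" where
  "is_tree T \<longleftrightarrow> [] \<notin> T \<and> (\<forall>xs ys. xs \<noteq> [] \<and> xs @ ys \<in> T \<longrightarrow> xs \<in> T)"

definition well_founded_tree :: "'a list set \<Rightarrow> bool" where
  "well_founded_tree T \<longleftrightarrow> \<not> (\<exists>x :: nat \<Rightarrow> 'a. \<forall>k. map x [0..<Suc k] \<in> T)"

definition tree_D :: "'a list set \<Rightarrow> 'a list set" where
  "tree_D T = {xs. xs \<noteq> [] \<and> (\<exists>x. xs @ [x] \<in> T)}"

definition tree_deriv :: "'a list set \<Rightarrow> ordw1 \<Rightarrow> 'a list set" where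
  "tree_deriv T = ord_rec T tree_D (\<lambda>\<alpha> f. \<Inter>\<beta>\<in>{..<\<alpha>}. f \<beta>)"

lemma tree_deriv_bot: "tree_deriv T bot = T"
  by (simp only: tree_deriv_def ord_rec_bot)

lemma tree_deriv_osuc: "\<alpha> < top \<Longrightarrow> tree_deriv T (osuc \<alpha>) = tree_D (tree_deriv T \<alpha>)"
  by (simp only: tree_deriv_def ord_rec_osuc)

lemma tree_deriv_limit: "is_limit \<alpha> \<Longrightarrow> tree_deriv T \<alpha> = (\<Inter>\<beta>\<in>{..<\<alpha>}. tree_deriv T \<beta>)"
  unfolding tree_deriv_def by (rule ord_rec_limit) (assumption, rule INF_cong, simp_all)

text \<open>
  As \<open>Inf {} = top\<close>, trees of uncountable order get the value \<open>top\<close>, and so do trees with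
  an infinite branch; the latter do not enter the index below.
\<close>
definition tree_order :: "'a list set \<Rightarrow> ordw1" where
  "tree_order T = Inf {\<alpha>. tree_deriv T \<alpha> = {}}"

definition equiv_l1_basis :: "real \<Rightarrow> 'a::real_normed_vector list \<Rightarrow> bool" where
  "equiv_l1_basis C xs \<longleftrightarrow> (\<exists>A B. 0 < A \<and> 0 < B \<and> A * B \<le> C \<and>
     (\<forall>a :: nat \<Rightarrow> real.
        (1 / A) * (\<Sum>i<length xs. \<bar>a i\<bar>) \<le> norm (\<Sum>i<length xs. a i *\<^sub>R xs ! i) \<and>
        norm (\<Sum>i<length xs. a i *\<^sub>R xs ! i) \<le> B * (\<Sum>i<length xs. \<bar>a i\<bar>)))"

definition is_l1_tree :: "real \<Rightarrow> 'a::real_normed_vector set \<Rightarrow> 'a list set \<Rightarrow> bool" where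
  "is_l1_tree C Y T \<longleftrightarrow> is_tree T \<and>
     (\<forall>xs\<in>T. set xs \<subseteq> Y \<and> (\<forall>x\<in>set xs. norm x = 1) \<and> equiv_l1_basis C xs)"

text \<open>
  The order is only considered for well-founded trees.  If \<open>Y\<close> does not contain \<open>\<ell>\<^sub>1\<close>, then
  every \<open>\<ell>\<^sub>1\<close>-tree on \<open>Y\<close> is well-founded, so the restriction excludes nothing; it
  guarantees that a lower bound for the index is never due to an infinite branch.
\<close>
definition bourgain_l1_index :: "'a::real_normed_vector set \<Rightarrow> ordw1" where
  "bourgain_l1_index Y =
     (SUP T\<in>{T. (\<exists>C\<ge>1. is_l1_tree C Y T) \<and> well_founded_tree T}. tree_order T)"

section \<open>Schreier families\<close>

text \<open>
  Inequalities between sets (and between numbers and sets) are understood elementwise and,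
  in a chain, between all pairs; the same family results whether or not the \<open>F\<^sub>i\<close> are allowed
  to be empty, and every family contains the empty set.
\<close>
definition schreier_step :: "nat set set \<Rightarrow> nat set set" where
  "schreier_step S = {\<Union>i\<in>{1..m}. F i | (m :: nat) F. 1 \<le> m \<and>
     (\<forall>i\<in>{1..m}. F i \<in> S \<and> (\<forall>k\<in>F i. m \<le> k)) \<and>
     (\<forall>i\<in>{1..m}. \<forall>j\<in>{1..m}. i < j \<longrightarrow> (\<forall>k\<in>F i. \<forall>l\<in>F j. k < l))}"

text \<open>\<open>seq \<zeta> n\<close> is the \<open>n\<close>-th term of the sequence chosen for the limit ordinal \<open>\<zeta>\<close>.\<close>
definition fundamental_sequences :: "(ordw1 \<Rightarrow> nat \<Rightarrow> ordw1) \<Rightarrow> bool" where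
  "fundamental_sequences seq \<longleftrightarrow> (\<forall>\<zeta><top. is_limit \<zeta> \<longrightarrow>
     (\<forall>n\<ge>1. seq \<zeta> n < \<zeta>) \<and> strict_mono_on {1..} (seq \<zeta>) \<and> (SUP n\<in>{1..}. seq \<zeta> n) = \<zeta>)"

definition schreier :: "(ordw1 \<Rightarrow> nat \<Rightarrow> ordw1) \<Rightarrow> ordw1 \<Rightarrow> nat set set" where
  "schreier seq = ord_rec (insert {} {{n} | n. 1 \<le> n}) schreier_step
     (\<lambda>\<zeta> f. {F. \<exists>n\<ge>1. seq \<zeta> n < \<zeta> \<and> F \<in> f (seq \<zeta> n) \<and> (\<forall>k\<in>F. n \<le> k)})"

lemma schreier_bot: "schreier seq bot = insert {} {{n} | n. 1 \<le> n}"
  by (simp only: schreier_def ord_rec_bot)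

lemma schreier_osuc: "\<xi> < top \<Longrightarrow> schreier seq (osuc \<xi>) = schreier_step (schreier seq \<xi>)"
  by (simp only: schreier_def ord_rec_osuc)

lemma schreier_limit:
  assumes "fundamental_sequences seq" "\<zeta> < top" "is_limit \<zeta>"
  shows "schreier seq \<zeta> = {F. \<exists>n\<ge>1. F \<in> schreier seq (seq \<zeta> n) \<and> (\<forall>k\<in>F. n \<le> k)}"
proof -
  have "schreier seq \<zeta> =
      {F. \<exists>n\<ge>1. seq \<zeta> n < \<zeta> \<and> F \<in> schreier seq (seq \<zeta> n) \<and> (\<forall>k\<in>F. n \<le> k)}"
    unfolding schreier_def by (rule ord_rec_limit[OF assms(3)]) (simp cong: conj_cong)
  then show ?thesis using assms by (auto simp: fundamental_sequences_def)
qed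

section \<open>The norming set\<close>

text \<open>
  Elements of \<open>c\<^sub>0\<^sub>0(\<nat>)\<close> are functions \<^typ>\<open>nat \<Rightarrow> real\<close>.  As \<open>\<nat> = {1, 2, \<dots>}\<close> here, they
  vanish at \<open>0\<close>.
\<close>
definition supp :: "(nat \<Rightarrow> real) \<Rightarrow> nat set" where
  "supp f = {k. f k \<noteq> 0}"

definition c00 :: "(nat \<Rightarrow> real) set" where
  "c00 = {x. finite (supp x) \<and> supp x \<subseteq> {1..}}"

definition unit_vec :: "nat \<Rightarrow> nat \<Rightarrow> real" where
  "unit_vec n = (\<lambda>k. if k = n then 1 else 0)"

definition act :: "(nat \<Rightarrow> real) \<Rightarrow> (nat \<Rightarrow> real) \<Rightarrow> real" where
  "act f x = (\<Sum>k\<in>supp x. f k * x k)"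

definition restr :: "nat set \<Rightarrow> (nat \<Rightarrow> real) \<Rightarrow> nat \<Rightarrow> real" where
  "restr E f = (\<lambda>k. if k \<in> E then f k else 0)"

definition interval :: "nat set \<Rightarrow> bool" where
  "interval E \<longleftrightarrow> E \<subseteq> {1..} \<and> (\<forall>a\<in>E. \<forall>b\<in>E. {a..b} \<subseteq> E)"

definition before :: "(nat \<Rightarrow> real) \<Rightarrow> (nat \<Rightarrow> real) \<Rightarrow> bool" where
  "before f g \<longleftrightarrow> Max (supp f) < Min (supp g)"

text \<open>The sequences \<open>m\<close>, \<open>n\<close> start at index \<open>1\<close>; the values at \<open>0\<close> are irrelevant.\<close>

fun m_seq :: "nat \<Rightarrow> nat" where
  "m_seq 0 = 1"
| "m_seq (Suc 0) = 2 ^ 5"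
| "m_seq (Suc (Suc j)) = m_seq (Suc j) ^ 5"

definition s_seq :: "nat \<Rightarrow> nat" where
  "s_seq j = (THE s. 2 ^ s = m_seq (Suc j) ^ 3)"

lemma m_seq_Suc: "m_seq (Suc j) = 2 ^ (5 ^ Suc j)"
proof (induction j)
  case (Suc j)
  then have "m_seq (Suc (Suc j)) = (2 ^ (5 ^ Suc j)) ^ 5" by (simp only: m_seq.simps)
  also have "\<dots> = 2 ^ (5 ^ Suc j * 5)" by (rule power_mult[symmetric])
  finally show ?case by (simp only: power_Suc2)
qed simp

lemma s_seq_spec: "2 ^ s_seq j = m_seq (Suc j) ^ 3"
proof -
  have "m_seq (Suc j) ^ 3 = 2 ^ (5 ^ Suc j * 3)"
    by (simp only: m_seq_Suc power_mult)
  then have "\<exists>!s. 2 ^ s = m_seq (Suc j) ^ 3"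
    by (metis power_inject_exp numeral_less_iff one_less_numeral_iff semiring_norm(76))
  then show ?thesis unfolding s_seq_def by (rule theI')
qed

fun n_seq :: "nat \<Rightarrow> nat" where
  "n_seq 0 = 1"
| "n_seq (Suc 0) = 2 ^ 6"
| "n_seq (Suc (Suc j)) = (2 * n_seq (Suc j)) ^ s_seq (Suc j)"

definition G0 :: "(nat \<Rightarrow> real) set" where
  "G0 = {(\<lambda>k. \<epsilon> * unit_vec n k) | \<epsilon> n. \<epsilon> \<in> {-1, 1} \<and> 1 \<le> n}"

definition G1_at :: "nat \<Rightarrow> (nat \<Rightarrow> real) set" where
  "G1_at j = {(\<lambda>k. 1 / (real (m_seq (2 * j - 1)))\<^sup>2 * (\<Sum>i\<in>B. \<epsilon> i * unit_vec i k)) | B \<epsilon>.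
     B \<subseteq> {1..} \<and> finite B \<and> 1 \<le> card B \<and> card B \<le> n_seq (2 * j - 1) \<and> (\<forall>i\<in>B. \<epsilon> i \<in> {-1, 1})}"

definition G1 :: "(nat \<Rightarrow> real) set" where
  "G1 = (\<Union>j\<in>{1..}. G1_at j)"

definition ind :: "(nat \<Rightarrow> real) \<Rightarrow> nat" where
  "ind f = (THE j. 1 \<le> j \<and> f \<in> G1_at j)"

definition U_seqs :: "(nat \<Rightarrow> real) list set" where
  "U_seqs = {fs. fs \<noteq> [] \<and> sorted_wrt before fs \<and>
     (\<exists>js. length js = length fs \<and> sorted_wrt (<) js \<and>
        (\<forall>i<length fs. 1 \<le> js ! i \<and> fs ! i \<in> G1_at (js ! i)))}"

definition coding :: "nat set \<Rightarrow> nat set \<Rightarrow> ((nat \<Rightarrow> real) list \<Rightarrow> nat) \<Rightarrow> bool" where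
  "coding M1 M2 \<sigma> \<longleftrightarrow>
     infinite M1 \<and> infinite M2 \<and> M1 \<inter> M2 = {} \<and> M1 \<union> M2 = {1..} \<and>
     \<sigma> ` U_seqs \<subseteq> M2 \<and> inj_on \<sigma> U_seqs \<and>
     (\<forall>fs f. fs \<in> U_seqs \<and> fs @ [f] \<in> U_seqs \<longrightarrow> \<sigma> fs < \<sigma> (fs @ [f]))"

definition special_seqs ::
  "nat set set \<Rightarrow> nat set \<Rightarrow> ((nat \<Rightarrow> real) list \<Rightarrow> nat) \<Rightarrow> (nat \<Rightarrow> real) list set" where
  "special_seqs S M1 \<sigma> = {fs \<in> U_seqs. (\<lambda>f. Min (supp f)) ` set fs \<in> S \<and>
     (\<exists>j\<in>M1. fs ! 0 \<in> G1_at j) \<and>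
     (\<forall>i. Suc i < length fs \<longrightarrow> fs ! Suc i \<in> G1_at (\<sigma> (take (Suc i) fs)))}"

definition signed_sum :: "nat set \<Rightarrow> (nat \<Rightarrow> real) \<Rightarrow> (nat \<Rightarrow> real) list \<Rightarrow> nat \<Rightarrow> real" where
  "signed_sum E \<epsilon> fs = restr E (\<lambda>k. \<Sum>i<length fs. \<epsilon> i * (fs ! i) k)"

text \<open>
  Pairs \<open>(\<phi>, ind \<phi>)\<close> with \<open>\<phi> \<in> G\<^sub>s\<^sub>p\<close>.  The index set does not depend on the representation of
  \<open>\<phi>\<close>, since it can be read off from the moduli of the non-zero coordinates of \<open>\<phi>\<close>.
\<close>
definition Gsp_ind ::
  "nat set set \<Rightarrow> nat set \<Rightarrow> ((nat \<Rightarrow> real) list \<Rightarrow> nat) \<Rightarrow> ((nat \<Rightarrow> real) \<times> nat set) set" where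
  "Gsp_ind S M1 \<sigma> = {(signed_sum E \<epsilon> fs, {ind f | f. f \<in> set fs \<and> restr E f \<noteq> (\<lambda>k. 0)}) | E \<epsilon> fs.
     fs \<in> special_seqs S M1 \<sigma> \<and> (\<forall>i<length fs. \<epsilon> i \<in> {-1, 1}) \<and> interval E}"

definition Gsp ::
  "nat set set \<Rightarrow> nat set \<Rightarrow> ((nat \<Rightarrow> real) list \<Rightarrow> nat) \<Rightarrow> (nat \<Rightarrow> real) set" where
  "Gsp S M1 \<sigma> = fst ` Gsp_ind S M1 \<sigma>"

definition G1_ind :: "((nat \<Rightarrow> real) \<times> nat set) set" where
  "G1_ind = {(\<phi>, {j}) | \<phi> j. 1 \<le> j \<and> \<phi> \<in> G1_at j}"

definition Gl2 ::
  "nat set set \<Rightarrow> nat set \<Rightarrow> ((nat \<Rightarrow> real) list \<Rightarrow> nat) \<Rightarrow> (nat \<Rightarrow> real) set" where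
  "Gl2 S M1 \<sigma> = {(\<lambda>k. \<Sum>i=1..d. a i * \<phi> i k) | (d :: nat) a \<phi>.
     1 \<le> d \<and> (\<forall>i\<in>{1..d}. a i \<in> \<rat>) \<and> (\<Sum>i=1..d. (a i)\<^sup>2) \<le> 1 \<and>
     (\<exists>I. (\<forall>i\<in>{1..d}. (\<phi> i, I i) \<in> Gsp_ind S M1 \<sigma> \<union> G1_ind) \<and>
          (\<forall>i\<in>{1..d}. \<forall>j\<in>{1..d}. i \<noteq> j \<longrightarrow> I i \<inter> I j = {}))}"

definition G_set ::
  "nat set set \<Rightarrow> nat set \<Rightarrow> ((nat \<Rightarrow> real) list \<Rightarrow> nat) \<Rightarrow> (nat \<Rightarrow> real) set" where
  "G_set S M1 \<sigma> = G0 \<union> G1 \<union> Gsp S M1 \<sigma> \<union> Gl2 S M1 \<sigma>"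

definition G_norm :: "(nat \<Rightarrow> real) set \<Rightarrow> (nat \<Rightarrow> real) \<Rightarrow> real" where
  "G_norm G x = (SUP \<phi>\<in>G. act \<phi> x)"

text \<open>
  The Banach space \<^typ>\<open>'a\<close> together with the embedding \<open>\<iota>\<close> is a completion of \<open>c\<^sub>0\<^sub>0(\<nat>)\<close> with
  norm \<open>N\<close>.  This determines \<^typ>\<open>'a\<close> up to isometric isomorphism.
\<close>
definition is_completion :: "((nat \<Rightarrow> real) \<Rightarrow> real) \<Rightarrow> ((nat \<Rightarrow> real) \<Rightarrow> 'a::banach) \<Rightarrow> bool" where
  "is_completion N \<iota> \<longleftrightarrow>
     (\<forall>x\<in>c00. \<forall>y\<in>c00. \<iota> (\<lambda>k. x k + y k) = \<iota> x + \<iota> y) \<and>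
     (\<forall>x\<in>c00. \<forall>c. \<iota> (\<lambda>k. c * x k) = c *\<^sub>R \<iota> x) \<and>
     (\<forall>x\<in>c00. norm (\<iota> x) = N x) \<and>
     closure (\<iota> ` c00) = UNIV"

end

theory Submission
  imports Defs
begin

text \<open>
  For a block \<open>B \<subseteq> M\<close> of \<open>n\<^bsub>2j-1\<^esub>\<close> elements let \<open>f = m\<^bsub>2j-1\<^esub>\<^sup>-\<^sup>2 \<Sum>\<^sub>i\<^sub>\<in>\<^sub>B e\<^sub>i\<^sup>*\<close> and let \<open>x\<close> be the multiple of
  \<open>\<Sum>\<^sub>i\<^sub>\<in>\<^sub>B e\<^sub>i\<close> with \<open>f x = 1\<close>.  The growth of \<open>(m\<^sub>j)\<close> and \<open>(n\<^sub>j)\<close> gives \<open>\<bar>g x\<bar> \<le> 2\<^bsup>-\<bar>k-j\<bar>\<^esup>\<close> for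
  functionals \<open>g\<close> of index \<open>k\<close>, so \<open>\<parallel>x\<parallel>\<close> is bounded.  Hence if \<open>(f\<^sub>1, \<dots>, f\<^sub>d)\<close> is special,
  the corresponding normalized averages are equivalent to the basis of \<open>\<ell>\<^sub>1\<^sup>d\<close> with a uniform constant,
  as the functionals \<open>\<Sum>\<^sub>i \<plusminus>f\<^sub>i\<close> show.  In building special sequences the minima of the supports can be
  taken arbitrarily large at each step, so the tree of these averages is as high as \<open>\<S>\<^sub>\<xi>\<close>, whose
  order is \<open>\<omega>\<^sup>\<xi>\<close>.  Putting one fixed basis vector in front of all sequences adds one more
  derivative and makes the inequality strict.
\<close>

section \<open>Ordinals and derived trees\<close>

lemma ord_induct [consumes 1, case_names bot osuc limit]:
  assumes "\<alpha> < top"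
    and "P bot"
    and "\<And>\<beta>. \<beta> < top \<Longrightarrow> P \<beta> \<Longrightarrow> P (osuc \<beta>)"
    and "\<And>\<zeta>. \<zeta> < top \<Longrightarrow> is_limit \<zeta> \<Longrightarrow> (\<And>\<beta>. \<beta> < \<zeta> \<Longrightarrow> P \<beta>) \<Longrightarrow> P \<zeta>"
  shows "P \<alpha>"
  using assms(1)
proof (induction \<alpha> rule: less_induct)
  case (less \<alpha>)
  then have IH: "\<And>\<beta>. \<beta> < \<alpha> \<Longrightarrow> P \<beta>" by (meson less_trans)
  show ?case
  proof (cases "\<alpha> = bot \<or> is_limit \<alpha>")
    case True
    then show ?thesis using assms(2) assms(4)[OF less.prems _ IH] by blast
  next
    case False
    then obtain \<beta> where "\<beta> < \<alpha>" "\<alpha> = osuc \<beta>" by (auto simp: is_limit_def)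
    then show ?thesis using assms(3)[of \<beta>] IH less.prems by (metis less_trans)
  qed
qed

lemma le_osuc_iff: "\<beta> < top \<Longrightarrow> \<alpha> \<le> osuc \<beta> \<longleftrightarrow> \<alpha> \<le> \<beta> \<or> \<alpha> = osuc \<beta>"
  by (metis leD le_less_linear less_imp_le order.antisym order.trans osuc_greater osuc_le order_refl)

text \<open>This is regularity of the first uncountable ordinal: the initial segment below the
  supremum is a countable union of countable initial segments.\<close>

lemma Sup_countable_less_top:
  fixes A :: "ordw1 set"
  assumes "countable A" "\<And>\<alpha>. \<alpha> \<in> A \<Longrightarrow> \<alpha> < top"
  shows "Sup A < top"
proof -
  have "{..<Sup A} \<subseteq> (\<Union>\<alpha>\<in>A. {..<\<alpha>})" by (auto simp: less_Sup_iff)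
  moreover have "countable (\<Union>\<alpha>\<in>A. {..<\<alpha>})"
    using assms by (intro countable_UN) (auto simp: less_top_iff_countable)
  ultimately show ?thesis by (auto simp: less_top_iff_countable intro: countable_subset)
qed

lemma SUP_lessThan_less_top:
  fixes f :: "ordw1 \<Rightarrow> ordw1"
  assumes "\<beta> < top" "\<And>\<gamma>. \<gamma> < \<beta> \<Longrightarrow> f \<gamma> < top"
  shows "(SUP \<gamma>\<in>{..<\<beta>}. f \<gamma>) < top"
  using assms by (intro Sup_countable_less_top) (auto simp: less_top_iff_countable)

lemma bot_less_top: "(bot :: ordw1) < top"
proof -
  have "{..<bot :: ordw1} = {}" by auto
  then show ?thesis by (simp add: less_top_iff_countable)
qed

lemma ord_add_less_top: "\<alpha> < top \<Longrightarrow> \<beta> < top \<Longrightarrow> ord_add \<alpha> \<beta> < top"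
  by (rotate_tac, induction \<beta> rule: ord_induct)
    (simp_all add: ord_add_bot ord_add_osuc osuc_less_top ord_add_limit SUP_lessThan_less_top)

lemma ord_mult_less_top: "\<alpha> < top \<Longrightarrow> \<beta> < top \<Longrightarrow> ord_mult \<alpha> \<beta> < top"
  by (rotate_tac, induction \<beta> rule: ord_induct)
    (simp_all add: ord_mult_bot ord_mult_osuc ord_add_less_top ord_mult_limit
      SUP_lessThan_less_top bot_less_top)

lemma finite_ord_less_top: "(osuc ^^ n) bot < top"
  by (induction n) (simp_all add: bot_less_top osuc_less_top)

lemma ord_omega_less_top: "ord_omega < top"
  unfolding ord_omega_def by (intro Sup_countable_less_top) (auto simp: finite_ord_less_top)

lemma finite_ord_less_omega: "(osuc ^^ n) bot < ord_omega"
proof -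
  have "(osuc ^^ n) bot < (osuc ^^ Suc n) bot"
    using osuc_greater[OF finite_ord_less_top] by simp
  also have "\<dots> \<le> ord_omega" unfolding ord_omega_def by (rule SUP_upper) simp
  finally show ?thesis .
qed

lemma lessThan_omega: "{..<ord_omega} = range (\<lambda>n. (osuc ^^ n) bot)"
proof -
  have "\<exists>n. \<gamma> = (osuc ^^ n) bot" if le: "\<gamma> \<le> (osuc ^^ k) bot" for \<gamma> k
    using le
  proof (induction k)
    case 0
    then show ?case by (intro exI[of _ 0]) (simp add: bot.extremum_unique)
  next
    case (Suc k)
    then show ?case
      using le_osuc_iff[OF finite_ord_less_top] by (auto intro: exI[of _ "Suc k"])
  qed
  then have "\<exists>n. \<gamma> = (osuc ^^ n) bot" if "\<gamma> < ord_omega" for \<gamma>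
    using that unfolding ord_omega_def less_SUP_iff by (blast intro: less_imp_le)
  then show ?thesis by (auto simp: finite_ord_less_omega)
qed

lemma is_limit_omega: "is_limit ord_omega"
proof -
  have "bot < ord_omega" using finite_ord_less_omega[of 0] by simp
  moreover have "ord_omega \<noteq> osuc \<beta>" if "\<beta> < ord_omega" for \<beta>
  proof -
    have "\<beta> \<in> range (\<lambda>n. (osuc ^^ n) bot)" using that lessThan_omega by auto
    then obtain n where "osuc \<beta> = (osuc ^^ Suc n) bot" by auto
    then show ?thesis using finite_ord_less_omega by (metis less_irrefl)
  qed
  ultimately show ?thesis unfolding is_limit_def by auto
qed

lemma ord_mult_omega: "ord_mult \<alpha> ord_omega = (SUP n. ord_mult \<alpha> ((osuc ^^ n) bot))"
  by (simp add: ord_mult_limit[OF is_limit_omega] lessThan_omega image_image)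

lemma ord_power_omega_less_top: "\<xi> < top \<Longrightarrow> ord_power ord_omega \<xi> < top"
  by (induction \<xi> rule: ord_induct)
    (simp_all add: ord_power_bot ord_power_osuc ord_mult_less_top ord_power_limit
      SUP_lessThan_less_top bot_less_top osuc_less_top ord_omega_less_top)

text \<open>Otherwise the supremum, and with it its successor, would lie below the limit \<zeta>,
  and the successor would be bounded by the supremum.\<close>

lemma Sup_lessThan_limit:
  assumes "is_limit \<zeta>" "\<zeta> < top"
  shows "Sup {..<\<zeta>} = \<zeta>"
proof (rule antisym)
  show "Sup {..<\<zeta>} \<le> \<zeta>" by (rule Sup_least) auto
  show "\<zeta> \<le> Sup {..<\<zeta>}"
  proof (rule ccontr)
    assume "\<not> \<zeta> \<le> Sup {..<\<zeta>}"
    then have lt: "Sup {..<\<zeta>} < \<zeta>" by simp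
    then have "osuc (Sup {..<\<zeta>}) < \<zeta>"
      using osuc_le[OF lt] assms(1) unfolding is_limit_def
      by (metis order.not_eq_order_implies_strict)
    then have "osuc (Sup {..<\<zeta>}) \<le> Sup {..<\<zeta>}" by (intro Sup_upper) simp
    then show False using osuc_greater[of "Sup {..<\<zeta>}"] lt assms(2) by (meson leD less_trans)
  qed
qed

lemma ord_add_bot_left: "\<beta> < top \<Longrightarrow> ord_add bot \<beta> = \<beta>"
  by (induction \<beta> rule: ord_induct)
    (simp_all add: ord_add_bot ord_add_osuc ord_add_limit Sup_lessThan_limit)

text \<open>Compare \<alpha> times one with \<alpha> times \<omega>. As \<open>ord_mult\<close> adds
  on the right, the product by one unfolds to \<open>ord_add bot \<alpha>\<close>, hence the appeal
  to \<open>ord_add_bot_left\<close>.\<close>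

lemma le_ord_mult_omega:
  assumes "\<alpha> < top"
  shows "\<alpha> \<le> ord_mult \<alpha> ord_omega"
proof -
  have "\<alpha> = ord_mult \<alpha> ((osuc ^^ 1) bot)"
    using assms by (simp add: ord_mult_osuc bot_less_top ord_mult_bot ord_add_bot_left)
  also have "\<dots> \<le> ord_mult \<alpha> ord_omega" unfolding ord_mult_omega by (rule SUP_upper) simp
  finally show ?thesis .
qed

lemma ord_power_omega_mono:
  "\<beta> < top \<Longrightarrow> \<alpha> \<le> \<beta> \<Longrightarrow> ord_power ord_omega \<alpha> \<le> ord_power ord_omega \<beta>"
proof (induction \<beta> rule: ord_induct)
  case bot
  then show ?case by (simp add: bot.extremum_unique)
next
  case (osuc \<beta>)
  show ?case
  proof (cases "\<alpha> = osuc \<beta>")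
    case False
    then have "ord_power ord_omega \<alpha> \<le> ord_power ord_omega \<beta>"
      using osuc by (simp add: le_osuc_iff)
    also have "\<dots> \<le> ord_power ord_omega (osuc \<beta>)"
      using osuc.hyps by (simp add: ord_power_osuc le_ord_mult_omega ord_power_omega_less_top)
    finally show ?thesis .
  qed simp
next
  case (limit \<zeta>)
  then show ?case
    by (cases "\<alpha> = \<zeta>") (auto simp: ord_power_limit intro!: SUP_upper)
qed

section \<open>Derived trees and their order\<close>

lemma is_tree_tree_D:
  assumes "is_tree T"
  shows "is_tree (tree_D T)"
proof -
  have "xs \<in> tree_D T" if xs: "xs \<noteq> []" "xs @ ys \<in> tree_D T" for xs ys
  proof (cases ys)
    case (Cons y zs)
    then obtain z where "(xs @ [y]) @ (zs @ [z]) \<in> T" using xs by (auto simp: tree_D_def)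
    then have "xs @ [y] \<in> T" using assms unfolding is_tree_def by blast
    then show ?thesis using xs(1) by (auto simp: tree_D_def)
  qed (use xs in simp)
  then show ?thesis by (auto simp: is_tree_def tree_D_def)
qed

lemma tree_D_subset: "is_tree T \<Longrightarrow> tree_D T \<subseteq> T"
  unfolding is_tree_def tree_D_def by auto

lemma is_tree_tree_deriv: "\<alpha> < top \<Longrightarrow> is_tree T \<Longrightarrow> is_tree (tree_deriv T \<alpha>)"
proof (induction \<alpha> rule: ord_induct)
  case (limit \<zeta>)
  \<comment> \<open>The intersection must run over a nonempty family: an empty intersection would
    contain the empty list.\<close>
  then have "bot < \<zeta>" by (simp add: is_limit_def bot.not_eq_extremum)
  then have "is_tree (\<Inter>\<beta>\<in>{..<\<zeta>}. tree_deriv T \<beta>)"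
    using limit.IH limit.prems unfolding is_tree_def by blast
  then show ?case by (simp add: tree_deriv_limit limit.hyps)
qed (simp_all add: tree_deriv_bot tree_deriv_osuc is_tree_tree_D)

lemma tree_deriv_antimono:
  "\<beta> < top \<Longrightarrow> is_tree T \<Longrightarrow> \<alpha> \<le> \<beta> \<Longrightarrow> tree_deriv T \<beta> \<subseteq> tree_deriv T \<alpha>"
proof (induction \<beta> arbitrary: \<alpha> rule: ord_induct)
  case bot
  then show ?case by (simp add: bot.extremum_unique)
next
  case (osuc \<beta>)
  show ?case
  proof (cases "\<alpha> = osuc \<beta>")
    case False
    then have "\<alpha> \<le> \<beta>" using osuc by (simp add: le_osuc_iff)
    then show ?thesis
      using osuc tree_D_subset[OF is_tree_tree_deriv[of \<beta> T]] by (auto simp: tree_deriv_osuc)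
  qed simp
next
  case (limit \<zeta>)
  show ?case
  proof (cases "\<alpha> = \<zeta>")
    case False
    then show ?thesis using limit by (auto simp: tree_deriv_limit)
  qed simp
qed

text \<open>Derivatives decrease, so only an unattained supremum is in question; it is a limit
  ordinal in which A is cofinal. This spares showing that suprema such as those arising from
  \<open>ord_add\<close> and \<open>ord_mult\<close> are limits.\<close>

lemma tree_deriv_Sup:
  assumes T: "is_tree T" and A: "A \<noteq> {}" "Sup A < top"
  shows "tree_deriv T (Sup A) = (\<Inter>\<alpha>\<in>A. tree_deriv T \<alpha>)"
proof
  show "tree_deriv T (Sup A) \<subseteq> (\<Inter>\<alpha>\<in>A. tree_deriv T \<alpha>)"
    using tree_deriv_antimono[OF A(2) T] by (auto dest: Sup_upper)
  show "(\<Inter>\<alpha>\<in>A. tree_deriv T \<alpha>) \<subseteq> tree_deriv T (Sup A)"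
  proof (cases "Sup A \<in> A")
    case False
    then have less: "\<alpha> < Sup A" if "\<alpha> \<in> A" for \<alpha>
      using that Sup_upper[of \<alpha> A] by (metis order.not_eq_order_implies_strict)
    have "is_limit (Sup A)"
      unfolding is_limit_def
    proof (intro conjI notI)
      show "Sup A = bot \<Longrightarrow> False" using less A(1) by (metis ex_in_conv not_less_bot)
      assume "\<exists>\<beta><Sup A. Sup A = osuc \<beta>"
      then obtain \<beta> where \<beta>: "\<beta> < Sup A" "Sup A = osuc \<beta>" by blast
      then have "\<alpha> \<le> \<beta>" if "\<alpha> \<in> A" for \<alpha>
        using less[OF that] osuc_le[of \<beta> \<alpha>] by (metis leD not_le)
      then have "Sup A \<le> \<beta>" by (rule Sup_least)
      then show False using \<beta> by simp
    qed
    then show ?thesis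
      using tree_deriv_antimono[OF _ T] A(2)
      by (auto simp: tree_deriv_limit less_Sup_iff)
        (meson Sup_upper less_imp_le order.strict_trans1 subsetD)
  qed auto
qed

lemma tree_deriv_add:
  assumes "\<alpha> < top" "is_tree T"
  shows "\<beta> < top \<Longrightarrow> tree_deriv T (ord_add \<alpha> \<beta>) = tree_deriv (tree_deriv T \<alpha>) \<beta>"
proof (induction \<beta> rule: ord_induct)
  case (limit \<zeta>)
  then have ne: "{..<\<zeta>} \<noteq> {}" by (auto simp: is_limit_def bot.not_eq_extremum)
  have "tree_deriv T (ord_add \<alpha> \<zeta>) = (\<Inter>\<gamma>\<in>ord_add \<alpha> ` {..<\<zeta>}. tree_deriv T \<gamma>)"
    using ord_add_less_top[OF assms(1) limit(1)] ne assms(2)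
    by (simp only: ord_add_limit[OF limit(2)]) (rule tree_deriv_Sup, auto)
  then show ?case using limit by (simp add: tree_deriv_limit)
qed (simp_all add: assms ord_add_bot tree_deriv_bot ord_add_osuc tree_deriv_osuc ord_add_less_top)

text \<open>An order at most \<alpha> < \<open>top\<close> would be attained, the ordinals being
  well-ordered, and then monotonicity would leave no node at \<alpha>.\<close>

lemma less_tree_order:
  assumes "is_tree T" "\<alpha> < top" "tree_deriv T \<alpha> \<noteq> {}"
  shows "\<alpha> < tree_order T"
proof (rule ccontr)
  let ?A = "{\<alpha>. tree_deriv T \<alpha> = {}}"
  assume "\<not> \<alpha> < tree_order T"
  then have le: "Inf ?A \<le> \<alpha>" by (simp add: tree_order_def)
  have "Inf ?A \<in> insert top ?A"
    unfolding Inf_ordw1_def by (rule LeastI[of _ top]) simp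
  moreover have "Inf ?A \<noteq> top" using le assms(2) by (metis leD)
  ultimately have "tree_deriv T (Inf ?A) = {}" by blast
  then show False using tree_deriv_antimono[OF assms(2,1) le] assms(3) by simp
qed

section \<open>Schreier families\<close>

lemma schreier_hereditary:
  assumes "\<xi> < top" "fundamental_sequences seq"
  shows "F \<in> schreier seq \<xi> \<Longrightarrow> G \<subseteq> F \<Longrightarrow> G \<in> schreier seq \<xi>"
  using assms(1)
proof (induction \<xi> arbitrary: F G rule: ord_induct)
  case bot
  then show ?case by (auto simp: schreier_bot subset_singleton_iff)
next
  case (osuc \<xi>)
  then obtain m F' where m: "1 \<le> m" and F: "F = (\<Union>i\<in>{1..m}. F' i)"
    and S: "\<forall>i\<in>{1..m}. F' i \<in> schreier seq \<xi> \<and> (\<forall>k\<in>F' i. m \<le> k)"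
    and ord: "\<forall>i\<in>{1..m}. \<forall>j\<in>{1..m}. i < j \<longrightarrow> (\<forall>k\<in>F' i. \<forall>l\<in>F' j. k < l)"
    by (auto simp: schreier_osuc schreier_step_def)
  \<comment> \<open>\<open>schreier_step\<close> admits empty blocks, so intersecting every block
    with G keeps the same m.\<close>
  let ?G = "\<lambda>i. F' i \<inter> G"
  have "G = (\<Union>i\<in>{1..m}. ?G i)" using F osuc.prems by auto
  moreover have "\<forall>i\<in>{1..m}. ?G i \<in> schreier seq \<xi> \<and> (\<forall>k\<in>?G i. m \<le> k)"
    using S osuc.IH by blast
  moreover have "\<forall>i\<in>{1..m}. \<forall>j\<in>{1..m}. i < j \<longrightarrow> (\<forall>k\<in>?G i. \<forall>l\<in>?G j. k < l)"
    using ord by blast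
  ultimately show ?case
    unfolding schreier_osuc[OF osuc.hyps] schreier_step_def using m by blast
next
  case (limit \<zeta>)
  have less: "seq \<zeta> n < \<zeta>" if "1 \<le> n" for n
    using assms(2) limit.hyps that by (simp add: fundamental_sequences_def)
  show ?case
    using limit.prems limit.IH[OF less]
    unfolding schreier_limit[OF assms(2) limit.hyps] by blast
qed

text \<open>In a cover by \<open>Suc m\<close> blocks, some point among the first \<open>k0\<close>
  misses the first block F, so it lies in a later one. All points from index \<open>k0\<close> on
  are larger and miss F as well, so the other m blocks must cover the shifted sequence, where the
  induction hypothesis applies.\<close>

lemma bounded_blocks_no_chain:
  fixes p :: "nat \<Rightarrow> nat"
  assumes her: "\<And>F G. F \<in> S \<Longrightarrow> G \<subseteq> F \<Longrightarrow> G \<in> S"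
    and chain: "\<And>p :: nat \<Rightarrow> nat. strict_mono p \<Longrightarrow> \<exists>k. p ` {..<k} \<notin> S"
  shows "strict_mono p \<Longrightarrow> \<exists>k. \<forall>Fs. length Fs = m \<longrightarrow> set Fs \<subseteq> S \<longrightarrow>
    sorted_wrt (\<lambda>A B. \<forall>a\<in>A. \<forall>b\<in>B. a < b) Fs \<longrightarrow> \<not> p ` {..<k} \<subseteq> \<Union>(set Fs)"
proof (induction m arbitrary: p)
  case 0
  show ?case by (rule exI[of _ 1]) auto
next
  case (Suc m)
  obtain k0 where k0: "p ` {..<k0} \<notin> S" using chain Suc.prems by blast
  have "strict_mono (\<lambda>i. p (i + k0))" using Suc.prems by (simp add: strict_mono_def)
  from Suc.IH[OF this] obtain k1 where k1: "\<And>Fs. length Fs = m \<Longrightarrow> set Fs \<subseteq> S \<Longrightarrow>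
    sorted_wrt (\<lambda>A B. \<forall>a\<in>A. \<forall>b\<in>B. a < b) Fs \<Longrightarrow>
    \<not> (\<lambda>i. p (i + k0)) ` {..<k1} \<subseteq> \<Union>(set Fs)"
    by blast
  have False if Fs: "length Fs = Suc m" "set Fs \<subseteq> S"
    "sorted_wrt (\<lambda>A B. \<forall>a\<in>A. \<forall>b\<in>B. a < b) Fs" "p ` {..<k0 + k1} \<subseteq> \<Union>(set Fs)" for Fs
  proof -
    obtain F Gs where FG: "Fs = F # Gs" using Fs(1) by (cases Fs) auto
    have "\<not> p ` {..<k0} \<subseteq> F" using k0 her Fs(2) FG by auto
    then obtain i where i: "i < k0" "p i \<notin> F" by auto
    then have "p i \<in> \<Union>(set Fs)" using Fs(4) by (meson image_subset_iff lessThan_iff trans_less_add1)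
    then obtain G where G: "G \<in> set Gs" "p i \<in> G" using i FG by auto
    have "p (j + k0) \<in> \<Union>(set Gs)" if "j < k1" for j
    proof -
      have "p i < p (j + k0)" using Suc.prems i by (simp add: strict_mono_less)
      then have "p (j + k0) \<notin> F" using Fs(3) FG G by force
      moreover have "p (j + k0) \<in> \<Union>(set Fs)"
        using that by (intro subsetD[OF Fs(4)] imageI) simp
      ultimately show ?thesis using FG by auto
    qed
    then have "(\<lambda>i. p (i + k0)) ` {..<k1} \<subseteq> \<Union>(set Gs)" by auto
    moreover have "\<not> (\<lambda>i. p (i + k0)) ` {..<k1} \<subseteq> \<Union>(set Gs)"
      using Fs(1-3) FG by (intro k1) auto
    ultimately show False by contradiction
  qed
  then show ?case by blast
qed

text \<open>A prefix longer than the finitely many chosen ones serves all parameters, by heredity;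
  \<open>k \<ge> 1\<close> keeps \<open>p 0\<close> in it.\<close>

lemma uniform_prefix_length:
  fixes P :: "nat \<Rightarrow> nat set \<Rightarrow> bool" and p :: "nat \<Rightarrow> nat"
  assumes "\<And>n. n \<le> b \<Longrightarrow> \<exists>k. \<not> P n (p ` {..<k})"
    and "\<And>n F G. n \<le> b \<Longrightarrow> P n F \<Longrightarrow> G \<subseteq> F \<Longrightarrow> P n G"
  shows "\<exists>k\<ge>1. \<forall>n\<le>b. \<not> P n (p ` {..<k})"
proof -
  obtain h where h: "\<And>n. n \<le> b \<Longrightarrow> \<not> P n (p ` {..<h n})" using assms(1) by metis
  define k where "k = Suc (\<Sum>n\<le>b. h n)"
  have "\<not> P n (p ` {..<k})" if "n \<le> b" for n
  proof
    assume "P n (p ` {..<k})"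
    moreover have "h n \<le> (\<Sum>n\<le>b. h n)" using that by (intro member_le_sum) auto
    then have "p ` {..<h n} \<subseteq> p ` {..<k}" by (intro image_mono) (auto simp: k_def)
    ultimately show False using assms(2) h that by blast
  qed
  then show ?thesis by (intro exI[of _ k]) (auto simp: k_def)
qed

text \<open>The first point \<open>p 0\<close> bounds the number m of blocks in the successor case
  and the index n of the fundamental sequence in the limit case. Finitely many parameters remain,
  and one prefix defeats them all. The result makes the tree of averages well-founded.\<close>

lemma schreier_no_chain:
  fixes p :: "nat \<Rightarrow> nat"
  assumes "\<xi> < top" "fundamental_sequences seq"
  shows "strict_mono p \<Longrightarrow> \<exists>k. p ` {..<k} \<notin> schreier seq \<xi>"
  using assms(1)
proof (induction \<xi> arbitrary: p rule: ord_induct)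
  case bot
  have "p ` {..<2} = {p 1, p 0}" by (simp add: numeral_2_eq_2 lessThan_Suc)
  moreover have "p 0 < p 1" using bot by (simp add: strict_mono_less)
  ultimately have "p ` {..<2} \<noteq> {}" "p ` {..<2} \<noteq> {n}" for n by auto
  then show ?case unfolding schreier_bot by blast
next
  case (osuc \<xi>)
  let ?S = "schreier seq \<xi>"
  \<comment> \<open>\<open>P m A\<close> says that m successive members of the family cover A,
    written as a negation to match \<open>bounded_blocks_no_chain\<close>.\<close>
  define P where "P m A \<longleftrightarrow> \<not> (\<forall>Fs. length Fs = m \<longrightarrow> set Fs \<subseteq> ?S \<longrightarrow>
    sorted_wrt (\<lambda>A B. \<forall>a\<in>A. \<forall>b\<in>B. a < b) Fs \<longrightarrow> \<not> A \<subseteq> \<Union>(set Fs))" for m A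
  have "\<exists>k\<ge>1. \<forall>m\<le>p 0. \<not> P m (p ` {..<k})"
  proof (rule uniform_prefix_length)
    show "\<exists>k. \<not> P m (p ` {..<k})" for m
      using bounded_blocks_no_chain[of ?S p m, OF schreier_hereditary[OF osuc.hyps assms(2)]
          osuc.IH osuc.prems] unfolding P_def not_not .
    show "P m G" if "P m F" "G \<subseteq> F" for m F G using that unfolding P_def by blast
  qed
  then obtain k where k: "k \<ge> 1" "\<And>m. m \<le> p 0 \<Longrightarrow> \<not> P m (p ` {..<k})" by blast
  have "p ` {..<k} \<notin> schreier seq (osuc \<xi>)"
  proof
    assume "p ` {..<k} \<in> schreier seq (osuc \<xi>)"
    then obtain m F where F: "p ` {..<k} = (\<Union>i\<in>{1..m}. F i)"
      and S: "\<forall>i\<in>{1..m}. F i \<in> ?S \<and> (\<forall>k\<in>F i. m \<le> k)"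
      and ord: "\<forall>i\<in>{1..m}. \<forall>j\<in>{1..m}. i < j \<longrightarrow> (\<forall>k\<in>F i. \<forall>l\<in>F j. k < l)"
      by (auto simp: schreier_osuc osuc.hyps schreier_step_def)
    have "p 0 \<in> p ` {..<k}" using k(1) by auto
    then have "m \<le> p 0" unfolding F using S by blast
    moreover have "P m (p ` {..<k})"
      unfolding P_def not_all not_imp not_not
    proof (intro exI[of _ "map F [1..<Suc m]"] conjI)
      show "set (map F [1..<Suc m]) \<subseteq> ?S" using S by auto
      show "sorted_wrt (\<lambda>A B. \<forall>a\<in>A. \<forall>b\<in>B. a < b) (map F [1..<Suc m])"
        unfolding sorted_wrt_map
      proof (rule sorted_wrt_mono_rel[OF _ sorted_wrt_upt])
        fix i j assume "i \<in> set [1..<Suc m]" "j \<in> set [1..<Suc m]" "i < j"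
        then have "i \<in> {1..m}" "j \<in> {1..m}" by auto
        then show "\<forall>a\<in>F i. \<forall>b\<in>F j. a < b" using ord \<open>i < j\<close> by blast
      qed
      show "p ` {..<k} \<subseteq> \<Union>(set (map F [1..<Suc m]))" unfolding F by auto
    qed simp
    ultimately show False using k(2) by blast
  qed
  then show ?case by blast
next
  case (limit \<zeta>)
  have less: "seq \<zeta> n < \<zeta>" if "1 \<le> n" for n
    using assms(2) limit.hyps that by (simp add: fundamental_sequences_def)
  define P where "P n A \<longleftrightarrow> 1 \<le> n \<and> A \<in> schreier seq (seq \<zeta> n)" for n A
  have "\<exists>k\<ge>1. \<forall>n\<le>p 0. \<not> P n (p ` {..<k})"
  proof (rule uniform_prefix_length)
    show "\<exists>k. \<not> P n (p ` {..<k})" for n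
      using limit.IH[OF less limit.prems] unfolding P_def by blast
    show "P n G" if "P n F" "G \<subseteq> F" for n F G
      using that less[of n] limit.hyps schreier_hereditary[OF _ assms(2)]
      unfolding P_def by (meson less_trans)
  qed
  then obtain k where k: "k \<ge> 1" "\<And>n. n \<le> p 0 \<Longrightarrow> \<not> P n (p ` {..<k})" by blast
  have "p ` {..<k} \<notin> schreier seq \<zeta>"
  proof
    assume "p ` {..<k} \<in> schreier seq \<zeta>"
    then obtain n where "1 \<le> n" "p ` {..<k} \<in> schreier seq (seq \<zeta> n)" "\<forall>l\<in>p ` {..<k}. n \<le> l"
      unfolding schreier_limit[OF assms(2) limit.hyps] by blast
    then show False using k unfolding P_def by auto
  qed
  then show ?case by blast
qed

section \<open>Derivatives of trees indexed by Schreier sets\<close>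

lemma sorted_wrt_concat_nth:
  "sorted_wrt P (concat xss) \<Longrightarrow> i < j \<Longrightarrow> j < length xss \<Longrightarrow>
    x \<in> set (xss ! i) \<Longrightarrow> y \<in> set (xss ! j) \<Longrightarrow> P x y"
proof (induction xss arbitrary: i j)
  case (Cons xs xss)
  then show ?case by (cases i; cases j) (auto simp: sorted_wrt_append dest: nth_mem)
qed simp

lemma concat_in_schreier_step:
  assumes "xss \<noteq> []" "\<forall>xs\<in>set xss. lab ` set xs \<in> S" "\<forall>x\<in>set (concat xss). length xss \<le> lab x"
    and "sorted_wrt (<) (map lab (concat xss))"
  shows "lab ` set (concat xss) \<in> schreier_step S"
  unfolding schreier_step_def
proof (intro CollectI exI conjI)
  \<comment> \<open>The sets in \<open>schreier_step\<close> are numbered from 1, list entries from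
    0.\<close>
  let ?m = "length xss" and ?F = "\<lambda>i. lab ` set (xss ! (i - 1))"
  have mem: "xss ! (i - 1) \<in> set xss" if "i \<in> {1..?m}" for i using that by auto
  have "{1..?m} = Suc ` {..<?m}" by (simp add: image_Suc_lessThan)
  then have "(\<Union>i\<in>{1..?m}. ?F i) = (\<Union>i\<in>{..<?m}. ?F (Suc i))" by simp
  also have "\<dots> = lab ` set (concat xss)" by (force simp: in_set_conv_nth)
  finally show "lab ` set (concat xss) = (\<Union>i\<in>{1..?m}. ?F i)" ..
  show "1 \<le> ?m" using assms(1) by (simp add: Suc_leI)
  show "\<forall>i\<in>{1..?m}. ?F i \<in> S \<and> (\<forall>k\<in>?F i. ?m \<le> k)" using mem assms(2,3) by auto
  show "\<forall>i\<in>{1..?m}. \<forall>j\<in>{1..?m}. i < j \<longrightarrow> (\<forall>k\<in>?F i. \<forall>l\<in>?F j. k < l)"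
  proof (intro ballI impI)
    fix i j k l assume ij: "i \<in> {1..?m}" "j \<in> {1..?m}" "i < j" and "k \<in> ?F i" "l \<in> ?F j"
    then obtain x y where xy: "x \<in> set (xss ! (i - 1))" "k = lab x"
      "y \<in> set (xss ! (j - 1))" "l = lab y" by auto
    have "lab x < lab y"
      by (rule sorted_wrt_concat_nth[of "\<lambda>x y. lab x < lab y" xss "i - 1" "j - 1"])
        (use assms(4) ij xy in \<open>auto simp: sorted_wrt_map\<close>)
    then show "k < l" using xy by simp
  qed
qed

text \<open>
  Quantifying over all trees \<open>T\<close> lets the successor step apply the induction hypothesis to
  the derived trees of \<open>T\<close>, one block of the Schreier set at a time.
\<close>
lemma node_in_tree_deriv:
  fixes V :: "'b list set" and lab :: "'b \<Rightarrow> nat" and y :: "'b \<Rightarrow> 'a"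
  assumes \<xi>: "\<xi> < top" and seq: "fundamental_sequences seq"
    and extend: "\<And>gs N. gs \<in> V \<Longrightarrow> \<exists>g. gs @ [g] \<in> V \<and> N \<le> lab g"
    and sorted: "\<And>gs. gs \<in> V \<Longrightarrow> sorted_wrt (<) (map lab gs)"
  shows "is_tree T \<Longrightarrow> gs \<in> V \<Longrightarrow>
    (\<And>hs. gs @ hs \<in> V \<Longrightarrow> \<forall>h\<in>set hs. N \<le> lab h \<Longrightarrow> lab ` set hs \<in> schreier seq \<xi> \<Longrightarrow>
      z # map y (gs @ hs) \<in> T) \<Longrightarrow>
    z # map y gs \<in> tree_deriv T (ord_power ord_omega \<xi>)"
  using \<xi>
proof (induction \<xi> arbitrary: T gs N rule: ord_induct)
  case bot
  \<comment> \<open>The label must be at least 1 for its singleton to belong to the family at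
    \<open>bot\<close>.\<close>
  obtain g where g: "gs @ [g] \<in> V" "max N 1 \<le> lab g" using extend bot.prems(2) by blast
  then have "lab ` set [g] \<in> schreier seq bot" by (auto simp: schreier_bot)
  then have "z # map y (gs @ [g]) \<in> T" using g by (intro bot.prems(3)) auto
  then show ?case
    by (auto simp: ord_power_bot tree_deriv_osuc bot_less_top tree_deriv_bot tree_D_def)
next
  case (osuc \<xi>)
  let ?a = "ord_power ord_omega \<xi>"
  have a: "?a < top" using osuc.hyps by (rule ord_power_omega_less_top)
  have mult: "ord_mult ?a ((osuc ^^ n) bot) < top" for n
    using a finite_ord_less_top by (rule ord_mult_less_top)
  \<comment> \<open>The n-th multiple of \<open>?a\<close> consumes n blocks from the family at
    \<xi>. In the inner step the first block is absorbed by the outer hypothesis, applied to the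
    tree derived by n multiples already, and the other n blocks by the inner hypothesis.\<close>
  have blocks: "z # map y gs \<in> tree_deriv T (ord_mult ?a ((osuc ^^ n) bot))"
    if "is_tree T" "gs \<in> V"
      "\<And>hss. length hss = n \<Longrightarrow> gs @ concat hss \<in> V \<Longrightarrow> \<forall>h\<in>set (concat hss). N \<le> lab h \<Longrightarrow>
        \<forall>hs\<in>set hss. lab ` set hs \<in> schreier seq \<xi> \<Longrightarrow> z # map y (gs @ concat hss) \<in> T"
    for n T gs N
    using that
  proof (induction n arbitrary: gs)
    case 0
    show ?case using "0.prems"(2) "0.prems"(3)[of "[]"] by (simp add: ord_mult_bot tree_deriv_bot)
  next
    case (Suc n)
    let ?b = "ord_mult ?a ((osuc ^^ n) bot)"
    have "z # map y gs \<in> tree_deriv (tree_deriv T ?b) ?a"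
    proof (rule osuc.IH)
      show "is_tree (tree_deriv T ?b)" using mult Suc.prems(1) by (rule is_tree_tree_deriv)
      fix hs assume hs: "gs @ hs \<in> V" "\<forall>h\<in>set hs. N \<le> lab h" "lab ` set hs \<in> schreier seq \<xi>"
      show "z # map y (gs @ hs) \<in> tree_deriv T ?b"
      proof (rule Suc.IH[OF Suc.prems(1) hs(1)])
        fix hss assume "length hss = n" "(gs @ hs) @ concat hss \<in> V"
          "\<forall>h\<in>set (concat hss). N \<le> lab h" "\<forall>hs\<in>set hss. lab ` set hs \<in> schreier seq \<xi>"
        then show "z # map y ((gs @ hs) @ concat hss) \<in> T"
          using Suc.prems(3)[of "hs # hss"] hs by auto
      qed
    qed (rule Suc.prems(2))
    then show ?case
      by (simp add: ord_mult_osuc finite_ord_less_top tree_deriv_add[OF mult Suc.prems(1) a])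
  qed
  have "z # map y gs \<in> tree_deriv T (ord_mult ?a ((osuc ^^ Suc n) bot))" for n
  proof (rule blocks[OF osuc.prems(1,2)])
    \<comment> \<open>Labels from \<open>Suc n\<close> on make a union of \<open>Suc n\<close>
      blocks a member of the next family; raising the bound N to the maximum secures this.\<close>
    fix hss assume hss: "length hss = Suc n" "gs @ concat hss \<in> V"
      "\<forall>h\<in>set (concat hss). max N (Suc n) \<le> lab h" "\<forall>hs\<in>set hss. lab ` set hs \<in> schreier seq \<xi>"
    have "sorted_wrt (<) (map lab (concat hss))"
      using sorted[OF hss(2)] by (simp add: sorted_wrt_append)
    then have "lab ` set (concat hss) \<in> schreier seq (osuc \<xi>)"
      unfolding schreier_osuc[OF osuc.hyps]
      using hss by (intro concat_in_schreier_step) auto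
    then show "z # map y (gs @ concat hss) \<in> T"
      using hss by (intro osuc.prems(3)) auto
  qed
  \<comment> \<open>\<open>concat_in_schreier_step\<close> needs at least one block, so the zeroth
    multiple is recovered from the first by monotonicity.\<close>
  moreover from this[of 0] have "z # map y gs \<in> T"
    using tree_deriv_antimono[OF mult[of "Suc 0"] osuc.prems(1) bot_least]
    by (auto simp: tree_deriv_bot)
  ultimately have "z # map y gs \<in> tree_deriv T (ord_mult ?a ((osuc ^^ n) bot))" for n
    by (cases n) (auto simp: ord_mult_bot tree_deriv_bot)
  moreover have "ord_mult ?a ord_omega < top"
    using a ord_omega_less_top by (rule ord_mult_less_top)
  then have "(SUP n. ord_mult ?a ((osuc ^^ n) bot)) < top" by (simp only: ord_mult_omega)
  ultimately show ?case
    by (simp add: ord_power_osuc osuc.hyps ord_mult_omega tree_deriv_Sup osuc.prems(1))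
next
  case (limit \<zeta>)
  have less: "seq \<zeta> n < \<zeta>" if "1 \<le> n" for n
    using seq limit.hyps that by (simp add: fundamental_sequences_def)
  have in_seq: "z # map y gs \<in> tree_deriv T (ord_power ord_omega (seq \<zeta> n))" if n: "1 \<le> n" for n
  proof (rule limit.IH[OF less[OF n] limit.prems(1,2)])
    fix hs assume hs: "gs @ hs \<in> V" "\<forall>h\<in>set hs. max N n \<le> lab h"
      "lab ` set hs \<in> schreier seq (seq \<zeta> n)"
    then have "lab ` set hs \<in> schreier seq \<zeta>"
      unfolding schreier_limit[OF seq limit.hyps] using n by auto
    then show "z # map y (gs @ hs) \<in> T" using hs by (intro limit.prems(3)) auto
  qed
  have ne: "{..<\<zeta>} \<noteq> {}" using limit.hyps by (auto simp: is_limit_def bot.not_eq_extremum)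
  \<comment> \<open>The fundamental sequence is cofinal in \<zeta>, and monotonicity passes from the
    power at some \<open>seq \<zeta> n\<close> above \<beta> to the power at \<beta>.\<close>
  have "z # map y gs \<in> tree_deriv T (ord_power ord_omega \<beta>)" if "\<beta> < \<zeta>" for \<beta>
  proof -
    have "\<beta> < (SUP n\<in>{1..}. seq \<zeta> n)"
      using seq limit.hyps that by (simp add: fundamental_sequences_def)
    then obtain n where n: "1 \<le> n" "\<beta> < seq \<zeta> n" by (auto simp: less_SUP_iff)
    then have lt: "seq \<zeta> n < top" using less limit.hyps by (meson less_trans)
    show ?thesis
      using tree_deriv_antimono[OF ord_power_omega_less_top[OF lt] limit.prems(1)
          ord_power_omega_mono[OF lt less_imp_le[OF n(2)]]] in_seq[OF n(1)] by blast
  qed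
  then have "z # map y gs \<in> (\<Inter>\<alpha>\<in>ord_power ord_omega ` {..<\<zeta>}. tree_deriv T \<alpha>)" by blast
  also have "\<dots> = tree_deriv T (ord_power ord_omega \<zeta>)"
    using ord_power_omega_less_top[OF limit.hyps(1)] ne
    by (simp only: ord_power_limit[OF limit.hyps(2)])
      (rule tree_deriv_Sup[symmetric], simp_all add: limit.prems)
  finally show ?case .
qed

section \<open>The norming set\<close>

lemma m_seq_eq: "1 \<le> n \<Longrightarrow> m_seq n = 2 ^ (5 ^ n)"
  by (cases n) (simp_all add: m_seq_Suc)

lemma m_seq_pos: "0 < m_seq n"
  by (cases n) (simp_all add: m_seq_Suc)

lemma two_power_le_m_seq: "2 ^ n \<le> m_seq n"
proof (cases n)
  case (Suc k)
  have "n < 5 ^ n" by (rule less_exp[THEN less_le_trans]) (simp add: power_mono)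
  then show ?thesis using Suc by (simp only: m_seq_Suc) (rule power_increasing, auto)
qed simp

lemma two_mult_m_seq_le: "2 * m_seq n \<le> m_seq (Suc n)"
proof (cases n)
  case (Suc k)
  have "2 * m_seq n = 2 ^ Suc (5 ^ n)" by (simp add: m_seq_eq Suc)
  also have "\<dots> \<le> 2 ^ (5 ^ Suc n)" by (rule power_increasing) (simp_all add: Suc_leI)
  also have "\<dots> = m_seq (Suc n)" by (simp only: m_seq_Suc)
  finally show ?thesis .
qed simp

lemma strict_mono_m_seq: "strict_mono m_seq"
proof (rule strict_mono_Suc_iff[THEN iffD2, rule_format])
  show "m_seq n < m_seq (Suc n)" for n
    using two_mult_m_seq_le[of n] m_seq_pos[of n] by linarith
qed

lemma m_seq_growth: "2 ^ d * m_seq n \<le> m_seq (n + d)"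
proof (induction d)
  case (Suc d)
  have "2 ^ Suc d * m_seq n \<le> 2 * m_seq (n + d)" using Suc by simp
  also have "\<dots> \<le> m_seq (n + Suc d)" using two_mult_m_seq_le[of "n + d"] by simp
  finally show ?case .
qed simp

lemma n_seq_pos: "0 < n_seq n"
  by (induction n rule: n_seq.induct) simp_all

text \<open>Since \<open>2 ^ s\<close> is the cube of the next m, \<open>(2 * n) ^ s\<close> is that
  cube times \<open>n ^ s\<close>, and \<open>n \<le> n ^ s\<close> as s is positive. Against the
  square in the weights the cube leaves a factor m to spare.\<close>

lemma n_seq_growth: "m_seq (Suc (Suc n)) ^ 3 * n_seq (Suc n) \<le> n_seq (Suc (Suc n))"
proof -
  have "s_seq (Suc n) \<noteq> 0"
  proof
    assume "s_seq (Suc n) = 0"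
    then have "m_seq (Suc (Suc n)) ^ 3 = 1" using s_seq_spec[of "Suc n"] by simp
    then have "m_seq (Suc (Suc n)) = 1" by simp
    then show False using strict_monoD[OF strict_mono_m_seq, of 0 "Suc (Suc n)"] by simp
  qed
  then have "n_seq (Suc n) \<le> n_seq (Suc n) ^ s_seq (Suc n)"
    using n_seq_pos[of "Suc n"] by (intro self_le_power) auto
  then show ?thesis
    by (simp only: n_seq.simps power_mult_distrib s_seq_spec mult_le_mono2)
qed

lemma n_seq_le_Suc: "n_seq n \<le> n_seq (Suc n)"
proof (cases n)
  case (Suc k)
  have "1 * n_seq n \<le> m_seq (Suc n) ^ 3 * n_seq n"
    by (intro mult_le_mono1) (simp add: Suc_le_eq m_seq_pos)
  also have "\<dots> \<le> n_seq (Suc n)" using n_seq_growth[of k] Suc by simp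
  finally show ?thesis by simp
qed simp

lemma n_seq_mono: "k \<le> n \<Longrightarrow> n_seq k \<le> n_seq n"
  using lift_Suc_mono_le[of n_seq] n_seq_le_Suc by blast

lemma n_seq_mult_le:
  assumes "1 \<le> k" "k < n"
  shows "m_seq n ^ 3 * n_seq k \<le> n_seq n"
proof -
  obtain l where l: "n = Suc (Suc l)"
    using assms by (cases n; cases "n - 1") auto
  have "m_seq n ^ 3 * n_seq k \<le> m_seq n ^ 3 * n_seq (Suc l)"
    using assms l by (intro mult_le_mono2 n_seq_mono) simp
  also have "\<dots> \<le> n_seq n" unfolding l by (rule n_seq_growth)
  finally show ?thesis .
qed

section \<open>Functionals of a fixed index\<close>

lemma G1_at_eq:
  "G1_at j = {(\<lambda>k. if k \<in> B then \<epsilon> k / (real (m_seq (2 * j - 1)))\<^sup>2 else 0) | B \<epsilon>.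
     B \<subseteq> {1..} \<and> finite B \<and> 1 \<le> card B \<and> card B \<le> n_seq (2 * j - 1) \<and> (\<forall>i\<in>B. \<epsilon> i \<in> {-1, 1})}"
proof -
  have "(\<Sum>i\<in>B. \<epsilon> i * unit_vec i k) = (if k \<in> B then \<epsilon> k else 0)"
    if "finite B" for B k and \<epsilon> :: "nat \<Rightarrow> real"
    using that by (simp add: unit_vec_def if_distrib sum.delta' cong: if_cong)
  then have eq: "finite B \<Longrightarrow> (\<lambda>k. 1 / (real (m_seq (2 * j - 1)))\<^sup>2 * (\<Sum>i\<in>B. \<epsilon> i * unit_vec i k)) =
    (\<lambda>k. if k \<in> B then \<epsilon> k / (real (m_seq (2 * j - 1)))\<^sup>2 else 0)"
    for B and \<epsilon> :: "nat \<Rightarrow> real"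
    by (simp add: fun_eq_iff)
  show ?thesis unfolding G1_at_def
  proof (intro Collect_cong iff_exI)
    fix f B \<epsilon>
    show "(f = (\<lambda>k. 1 / (real (m_seq (2 * j - 1)))\<^sup>2 * (\<Sum>i\<in>B. \<epsilon> i * unit_vec i k)) \<and>
        B \<subseteq> {1..} \<and> finite B \<and> 1 \<le> card B \<and> card B \<le> n_seq (2 * j - 1) \<and> (\<forall>i\<in>B. \<epsilon> i \<in> {-1, 1})) =
      (f = (\<lambda>k. if k \<in> B then \<epsilon> k / (real (m_seq (2 * j - 1)))\<^sup>2 else 0) \<and>
        B \<subseteq> {1..} \<and> finite B \<and> 1 \<le> card B \<and> card B \<le> n_seq (2 * j - 1) \<and> (\<forall>i\<in>B. \<epsilon> i \<in> {-1, 1}))"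
      by (cases "finite B") (simp_all only: eq simp_thms)
  qed
qed

lemma G1_at_cases:
  assumes "f \<in> G1_at j"
  obtains "supp f \<subseteq> {1..}" "finite (supp f)" "supp f \<noteq> {}" "card (supp f) \<le> n_seq (2 * j - 1)"
    "\<And>k. k \<in> supp f \<Longrightarrow> \<bar>f k\<bar> = 1 / (real (m_seq (2 * j - 1)))\<^sup>2"
proof -
  obtain B \<epsilon> where B: "B \<subseteq> {1..}" "finite B" "1 \<le> card B" "card B \<le> n_seq (2 * j - 1)"
    and \<epsilon>: "\<And>i. i \<in> B \<Longrightarrow> \<epsilon> i \<in> {-1, 1}"
    and f: "f = (\<lambda>k. if k \<in> B then \<epsilon> k / (real (m_seq (2 * j - 1)))\<^sup>2 else 0)"
    using assms unfolding G1_at_eq by blast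
  have \<epsilon>0: "\<epsilon> i \<noteq> 0" if "i \<in> B" for i using \<epsilon>[OF that] by auto
  have "supp f = B"
    using \<epsilon>0 m_seq_pos[of "2 * j - 1"] by (auto simp: supp_def f)
  moreover have "\<bar>f k\<bar> = 1 / (real (m_seq (2 * j - 1)))\<^sup>2" if "k \<in> B" for k
    using \<epsilon>[OF that] that by (auto simp: f)
  moreover have "B \<noteq> {}" using B(3) by auto
  ultimately show thesis using that B by auto
qed

lemma abs_G1_at_le:
  assumes "f \<in> G1_at j"
  shows "\<bar>f k\<bar> \<le> 1 / (real (m_seq (2 * j - 1)))\<^sup>2"
proof (cases "k \<in> supp f")
  case True
  then show ?thesis using assms by (metis G1_at_cases order_refl)
qed (simp add: supp_def)

text \<open>A restriction keeps the weight and only shrinks the support. Hence the pieces of a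
  special functional cut by an interval obey the estimates for \<open>G1_at\<close>.\<close>

lemma restr_G1_at:
  assumes "f \<in> G1_at j" "restr E f \<noteq> (\<lambda>k. 0)"
  shows "restr E f \<in> G1_at j"
proof -
  obtain B \<epsilon> where B: "B \<subseteq> {1..}" "finite B" "1 \<le> card B" "card B \<le> n_seq (2 * j - 1)"
    and \<epsilon>: "\<forall>i\<in>B. \<epsilon> i \<in> {-1, 1}"
    and f: "f = (\<lambda>k. if k \<in> B then \<epsilon> k / (real (m_seq (2 * j - 1)))\<^sup>2 else 0)"
    using assms(1) unfolding G1_at_eq by blast
  have E: "restr E f = (\<lambda>k. if k \<in> B \<inter> E then \<epsilon> k / (real (m_seq (2 * j - 1)))\<^sup>2 else 0)"
    by (auto simp: restr_def f)
  have "B \<inter> E \<noteq> {}"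
  proof
    assume "B \<inter> E = {}"
    then show False using assms(2) by (simp only: E) simp
  qed
  then have "1 \<le> card (B \<inter> E)" using B by (simp add: Suc_le_eq card_gt_0_iff)
  moreover have "card (B \<inter> E) \<le> card B" using B by (intro card_mono) auto
  ultimately show ?thesis
    unfolding G1_at_eq E using B \<epsilon>
    by (intro CollectI exI[of _ "B \<inter> E"] exI[of _ \<epsilon>]) auto
qed

text \<open>The common modulus of the nonzero coordinates determines
  \<open>m_seq (2 * j - 1)\<close>, and \<open>m_seq\<close> is strictly increasing.\<close>

lemma ind_eq:
  assumes "1 \<le> j" "f \<in> G1_at j"
  shows "ind f = j"
  unfolding ind_def
proof (rule the_equality)
  fix i assume i: "1 \<le> i \<and> f \<in> G1_at i"
  obtain k where "k \<in> supp f" using assms(2) by (rule G1_at_cases) blast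
  then have "1 / (real (m_seq (2 * i - 1)))\<^sup>2 = 1 / (real (m_seq (2 * j - 1)))\<^sup>2"
    using i assms(2) by (metis G1_at_cases)
  then have "m_seq (2 * i - 1) = m_seq (2 * j - 1)" by simp
  then have "2 * i - 1 = 2 * j - 1" by (simp only: strict_mono_eq[OF strict_mono_m_seq])
  then show "i = j" using i assms(1) by simp
qed (use assms in auto)

section \<open>Bounds for the action of the norming functionals\<close>

lemma act_sum_left:
  "act (\<lambda>k. \<Sum>i\<in>I. a i * f i k) x = (\<Sum>i\<in>I. a i * act (f i) x)"
  unfolding act_def by (simp add: sum_distrib_left sum_distrib_right mult.assoc) (rule sum.swap)

lemma act_eq_sum:
  assumes "finite A" "supp x \<subseteq> A"
  shows "act f x = (\<Sum>k\<in>A. f k * x k)"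
  unfolding act_def by (rule sum.mono_neutral_left) (use assms in \<open>auto simp: supp_def\<close>)

lemma act_unit_vec:
  assumes "finite (supp x)"
  shows "act (\<lambda>k. \<epsilon> * unit_vec n k) x = \<epsilon> * x n"
proof -
  have "act (\<lambda>k. \<epsilon> * unit_vec n k) x = (\<Sum>k\<in>insert n (supp x). \<epsilon> * unit_vec n k * x k)"
    using assms by (intro act_eq_sum) auto
  also have "\<dots> = (\<Sum>k\<in>{n}. \<epsilon> * unit_vec n k * x k)"
    using assms by (intro sum.mono_neutral_right) (auto simp: unit_vec_def)
  finally show ?thesis by (simp add: unit_vec_def)
qed

text \<open>
  The coefficients \<open>a\<^sub>i\<close> in the definition of \<open>G\<^sub>\<ell>\<^sub>2\<close> are only used through \<open>\<bar>a\<^sub>i\<bar> \<le> 1\<close>: since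
  the index sets are disjoint, each weight \<open>c\<^sub>k\<close> is counted at most once.
\<close>
lemma Gsp_ind_bound:
  assumes c: "\<And>k. 0 \<le> c k" and G1: "\<And>k f. 1 \<le> k \<Longrightarrow> f \<in> G1_at k \<Longrightarrow> \<bar>act f x\<bar> \<le> c k"
    and \<phi>: "(\<phi>, I) \<in> Gsp_ind S M1 \<sigma> \<union> G1_ind"
  shows "finite I" "I \<subseteq> {1..}" "\<bar>act \<phi> x\<bar> \<le> sum c I"
proof -
  have "finite I \<and> I \<subseteq> {1..} \<and> \<bar>act \<phi> x\<bar> \<le> sum c I"
  proof (cases "(\<phi>, I) \<in> G1_ind")
    case True
    then show ?thesis using G1 by (auto simp: G1_ind_def)
  next
    case False
    then obtain E \<epsilon> fs where \<phi>_def: "\<phi> = signed_sum E \<epsilon> fs"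
      and I: "I = {ind f | f. f \<in> set fs \<and> restr E f \<noteq> (\<lambda>k. 0)}"
      and fs: "fs \<in> special_seqs S M1 \<sigma>" and \<epsilon>: "\<forall>i<length fs. \<epsilon> i \<in> {-1, 1}"
      using \<phi> unfolding Gsp_ind_def by blast
    obtain js where js: "length js = length fs" "sorted_wrt (<) js"
      "\<forall>i<length fs. 1 \<le> js ! i \<and> fs ! i \<in> G1_at (js ! i)"
      using fs unfolding special_seqs_def U_seqs_def by blast
    \<comment> \<open>Functionals annihilated by E contribute neither to \<phi> nor to I; the others
      have distinct indices, so each weight occurs once.\<close>
    let ?R = "{i. i < length fs \<and> restr E (fs ! i) \<noteq> (\<lambda>k. 0)}"
    have "I = (\<lambda>i. ind (fs ! i)) ` ?R"
      unfolding I by (auto simp: in_set_conv_nth)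
    also have "\<dots> = (\<lambda>i. js ! i) ` ?R"
      using js(3) by (intro image_cong) (auto simp: ind_eq)
    finally have I': "I = (\<lambda>i. js ! i) ` ?R" .
    have inj: "inj_on (\<lambda>i. js ! i) ?R"
      using js(1,2) by (auto simp: inj_on_def nth_eq_iff_index_eq strict_sorted_iff)
    have "\<phi> = (\<lambda>k. \<Sum>i<length fs. \<epsilon> i * restr E (fs ! i) k)"
      by (auto simp: \<phi>_def signed_sum_def restr_def)
    then have "\<bar>act \<phi> x\<bar> \<le> (\<Sum>i<length fs. \<bar>\<epsilon> i * act (restr E (fs ! i)) x\<bar>)"
      by (simp add: act_sum_left sum_abs)
    also have "\<dots> = (\<Sum>i<length fs. \<bar>act (restr E (fs ! i)) x\<bar>)"
      using \<epsilon> by (intro sum.cong) (auto simp: abs_mult)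
    also have "\<dots> = (\<Sum>i\<in>?R. \<bar>act (restr E (fs ! i)) x\<bar>)"
      by (rule sum.mono_neutral_right) (auto simp: act_def)
    also have "\<dots> \<le> (\<Sum>i\<in>?R. c (js ! i))"
      using js(3) by (intro sum_mono G1 restr_G1_at) auto
    also have "\<dots> = sum c I" unfolding I' by (simp add: sum.reindex[OF inj])
    finally show ?thesis using js(3) by (auto simp: I')
  qed
  then show "finite I" "I \<subseteq> {1..}" "\<bar>act \<phi> x\<bar> \<le> sum c I" by auto
qed

text \<open>This reduces a norm estimate to one weight \<open>c k\<close> per index: functionals
  outside \<open>G0\<close> are dominated by the weights of finitely many distinct indices, those in
  \<open>G0\<close> by the bound on coordinates.\<close>

lemma G_set_bound:
  assumes c: "\<And>k. 0 \<le> c k" and G1: "\<And>k f. 1 \<le> k \<Longrightarrow> f \<in> G1_at k \<Longrightarrow> \<bar>act f x\<bar> \<le> c k"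
    and C: "\<And>K. finite K \<Longrightarrow> K \<subseteq> {1..} \<Longrightarrow> sum c K \<le> C" and x: "\<And>n. \<bar>x n\<bar> \<le> C"
    and fin: "finite (supp x)" and \<phi>: "\<phi> \<in> G_set S M1 \<sigma>"
  shows "\<bar>act \<phi> x\<bar> \<le> C"
proof -
  have bound: "finite I" "I \<subseteq> {1..}" "\<bar>act \<psi> x\<bar> \<le> sum c I"
    if "(\<psi>, I) \<in> Gsp_ind S M1 \<sigma> \<union> G1_ind" for \<psi> I
    by (rule Gsp_ind_bound[OF c G1 that]; assumption)+
  consider "\<phi> \<in> G0" | I where "(\<phi>, I) \<in> Gsp_ind S M1 \<sigma> \<union> G1_ind" | "\<phi> \<in> Gl2 S M1 \<sigma>"
    using \<phi> unfolding G_set_def Gsp_def G1_def G1_ind_def by force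
  then show ?thesis
  proof cases
    case 1
    then obtain \<epsilon> n where \<epsilon>: "\<phi> = (\<lambda>k. \<epsilon> * unit_vec n k)" "\<epsilon> \<in> {-1, 1}"
      unfolding G0_def by blast
    show ?thesis using x \<epsilon> by (auto simp: act_unit_vec[OF fin] abs_mult)
  next
    case 2
    show ?thesis using bound(3)[OF 2] C[OF bound(1,2)[OF 2]] by (rule order_trans)
  next
    case 3
    then obtain d :: nat and a \<psi> I where \<phi>_def: "\<phi> = (\<lambda>k. \<Sum>i=1..d. a i * \<psi> i k)"
      and a: "(\<Sum>i=1..d. (a i)\<^sup>2) \<le> 1"
      and \<psi>': "\<forall>i\<in>{1..d}. (\<psi> i, I i) \<in> Gsp_ind S M1 \<sigma> \<union> G1_ind"
      and disj: "\<forall>i\<in>{1..d}. \<forall>j\<in>{1..d}. i \<noteq> j \<longrightarrow> I i \<inter> I j = {}"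
      unfolding Gl2_def mem_Collect_eq by (elim exE conjE) (rule that, assumption+)
    from \<psi>' have \<psi>: "(\<psi> i, I i) \<in> Gsp_ind S M1 \<sigma> \<union> G1_ind" if "i \<in> {1..d}" for i
      using that by (rule bspec)
    have "\<bar>a i\<bar> \<le> 1" if "i \<in> {1..d}" for i
    proof -
      have "(a i)\<^sup>2 \<le> (\<Sum>i=1..d. (a i)\<^sup>2)" using that by (intro member_le_sum) auto
      then have "(a i)\<^sup>2 \<le> 1" using a by (rule order_trans)
      then show ?thesis by (simp add: abs_square_le_1)
    qed
    then have "\<bar>a i * act (\<psi> i) x\<bar> \<le> sum c (I i)" if "i \<in> {1..d}" for i
      using that bound(3)[OF \<psi>[OF that]]
      by (metis abs_ge_zero abs_mult mult_left_le_one_le order_trans)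
    then have "(\<Sum>i=1..d. \<bar>a i * act (\<psi> i) x\<bar>) \<le> (\<Sum>i=1..d. sum c (I i))"
      by (rule sum_mono)
    then have "\<bar>act \<phi> x\<bar> \<le> (\<Sum>i=1..d. sum c (I i))"
      unfolding \<phi>_def act_sum_left by (rule order_trans[OF sum_abs])
    also have "\<dots> = sum c (\<Union>i\<in>{1..d}. I i)"
      using disj bound(1)[OF \<psi>] by (intro sum.UNION_disjoint[symmetric]) auto
    also have "\<dots> \<le> C" by (intro C finite_UN_I UN_least bound(1,2)[OF \<psi>]) auto
    finally show ?thesis .
  qed
qed

lemma sum_half_powers_le: "finite I \<Longrightarrow> (\<Sum>i\<in>I. (1/2::real) ^ i) \<le> 2"
  using sum_le_suminf[of "\<lambda>i. (1/2::real) ^ i" I] suminf_geometric[of "1/2::real"]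
  by (simp add: summable_geometric)

lemma sum_half_powers_le_1:
  assumes "finite K" "K \<subseteq> {1..}"
  shows "(\<Sum>i\<in>K. (1/2::real) ^ i) \<le> 1"
proof -
  have "0 \<notin> K" using assms(2) by auto
  then show ?thesis using sum_half_powers_le[of "insert 0 K"] assms(1) by simp
qed

text \<open>Coefficients of index k are at most \<open>(1/2) ^ k\<close>, so the l1 norm of x times
  this power serves as weight. The bound makes the supremum in \<open>G_norm\<close> one of a set
  bounded above.\<close>

lemma G_set_bound_l1:
  assumes "x \<in> c00" "\<phi> \<in> G_set S M1 \<sigma>"
  shows "\<bar>act \<phi> x\<bar> \<le> (\<Sum>i\<in>supp x. \<bar>x i\<bar>)"
proof (rule G_set_bound[where c = "\<lambda>k. (\<Sum>i\<in>supp x. \<bar>x i\<bar>) * (1/2) ^ k"])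
  let ?L = "\<Sum>i\<in>supp x. \<bar>x i\<bar>"
  have L: "0 \<le> ?L" by (rule sum_nonneg) simp
  then show "0 \<le> ?L * (1/2) ^ k" for k :: nat by simp
  show "finite (supp x)" using assms(1) by (simp add: c00_def)
  show "\<bar>act f x\<bar> \<le> ?L * (1/2) ^ k" if k: "1 \<le> k" and f: "f \<in> G1_at k" for k f
  proof -
    have "2 ^ k \<le> (2 :: nat) ^ (2 * k - 1)" using k by (intro power_increasing) auto
    also have "\<dots> \<le> m_seq (2 * k - 1)" by (rule two_power_le_m_seq)
    also have "\<dots> \<le> (m_seq (2 * k - 1))\<^sup>2"
      using m_seq_pos by (intro self_le_power) (auto simp: Suc_le_eq)
    finally have "real (2 ^ k) \<le> real ((m_seq (2 * k - 1))\<^sup>2)" by (simp only: of_nat_le_iff)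
    then have "1 / (real (m_seq (2 * k - 1)))\<^sup>2 \<le> 1 / 2 ^ k"
      by (intro divide_left_mono) (auto simp: m_seq_pos)
    then have "\<bar>f i\<bar> \<le> (1/2) ^ k" for i
      using abs_G1_at_le[OF f, of i] by (simp add: power_one_over)
    then have "(\<Sum>i\<in>supp x. \<bar>f i * x i\<bar>) \<le> (\<Sum>i\<in>supp x. (1/2) ^ k * \<bar>x i\<bar>)"
      by (intro sum_mono) (simp add: abs_mult mult_right_mono)
    also have "\<dots> = ?L * (1/2) ^ k"
      by (subst sum_distrib_right) (simp add: mult.commute)
    finally show ?thesis
      unfolding act_def by (rule order_trans[OF sum_abs])
  qed
  show "(\<Sum>k\<in>K. ?L * (1/2) ^ k) \<le> ?L" if "finite K" "K \<subseteq> {1..}" for K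
    using mult_left_mono[OF sum_half_powers_le_1[OF that] L] by (simp add: sum_distrib_left)
  show "\<bar>x n\<bar> \<le> ?L" for n
  proof (cases "n \<in> supp x")
    case True
    then show ?thesis using assms(1) by (intro member_le_sum) (auto simp: c00_def)
  qed (use L in \<open>simp add: supp_def\<close>)
qed (rule assms(2))

lemma act_le_G_norm:
  assumes "x \<in> c00" "\<phi> \<in> G_set S M1 \<sigma>"
  shows "act \<phi> x \<le> G_norm (G_set S M1 \<sigma>) x"
  unfolding G_norm_def
  using assms(2)
  by (rule cSUP_upper) (rule bdd_aboveI2, rule abs_le_D1, erule G_set_bound_l1[OF assms(1)])

lemma G_norm_le:
  assumes "\<And>\<phi>. \<phi> \<in> G_set S M1 \<sigma> \<Longrightarrow> \<bar>act \<phi> x\<bar> \<le> C"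
  shows "G_norm (G_set S M1 \<sigma>) x \<le> C"
  unfolding G_norm_def
proof (rule cSUP_least)
  have "(\<lambda>k. 1 * unit_vec 1 k) \<in> G0" unfolding G0_def by blast
  then show "G_set S M1 \<sigma> \<noteq> {}" by (auto simp: G_set_def)
  show "act \<phi> x \<le> C" if "\<phi> \<in> G_set S M1 \<sigma>" for \<phi> using assms[OF that] by simp
qed

text \<open>\<open>G0\<close> contains both signs of every coordinate functional. The estimate
  yields injectivity of \<iota> and isolates the leading vector of a node.\<close>

lemma abs_coord_le_G_norm:
  assumes "x \<in> c00"
  shows "\<bar>x n\<bar> \<le> G_norm (G_set S M1 \<sigma>) x"
proof -
  let ?N = "G_norm (G_set S M1 \<sigma>) x"
  have *: "\<epsilon> * x n \<le> ?N" if "1 \<le> n" "\<epsilon> \<in> {-1, 1}" for \<epsilon> n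
  proof -
    have "(\<lambda>k. \<epsilon> * unit_vec n k) \<in> G_set S M1 \<sigma>"
      using that unfolding G_set_def G0_def by blast
    then show ?thesis using act_le_G_norm[OF assms] assms
      by (metis (no_types, lifting) act_unit_vec c00_def mem_Collect_eq)
  qed
  have "x 0 = 0" using assms by (auto simp: c00_def supp_def)
  moreover have "0 \<le> ?N" using *[of 1 1] *[of 1 "-1"] by simp
  moreover have "1 \<le> n \<Longrightarrow> \<bar>x n\<bar> \<le> ?N" using *[of n 1] *[of n "-1"] by simp
  ultimately show ?thesis by (cases "n = 0") auto
qed

section \<open>Normalized averages\<close>

text \<open>A pair of an index and a block encodes a functional together with its dual average, so
  branches can be lists of such pairs.\<close>

definition avg_fun :: "nat \<times> nat set \<Rightarrow> nat \<Rightarrow> real" where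
  "avg_fun = (\<lambda>(j, B) k. if k \<in> B then 1 / (real (m_seq (2 * j - 1)))\<^sup>2 else 0)"

definition avg_vec :: "nat \<times> nat set \<Rightarrow> nat \<Rightarrow> real" where
  "avg_vec = (\<lambda>(j, B) k. if k \<in> B then (real (m_seq (2 * j - 1)))\<^sup>2 / card B else 0)"

text \<open>The size is the largest that \<open>G1_at j\<close> admits; it spreads the average so
  thinly that functionals of smaller index hardly see it.\<close>

definition avg_block :: "nat set \<Rightarrow> (nat \<times> nat set) set" where
  "avg_block A = {(j, B). 1 \<le> j \<and> B \<subseteq> A \<inter> {1..} \<and> finite B \<and> card B = n_seq (2 * j - 1)}"

lemma avg_block_nonempty: "(j, B) \<in> avg_block A \<Longrightarrow> B \<noteq> {}"
  using n_seq_pos[of "2 * j - 1"] by (auto simp: avg_block_def)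

lemma avg_fun_in_G1_at: "(j, B) \<in> avg_block A \<Longrightarrow> avg_fun (j, B) \<in> G1_at j"
  unfolding avg_fun_def avg_block_def G1_at_eq
  by (auto simp: Suc_le_eq n_seq_pos fun_eq_iff intro!: exI[of _ B] exI[of _ "\<lambda>_. 1"])

lemma supp_avg_fun: "supp (avg_fun (j, B)) = B"
  using m_seq_pos[of "2 * j - 1"] by (auto simp: supp_def avg_fun_def)

lemma supp_avg_vec: "(j, B) \<in> avg_block A \<Longrightarrow> supp (avg_vec (j, B)) = B"
  using m_seq_pos[of "2 * j - 1"] by (auto simp: supp_def avg_vec_def avg_block_def n_seq_pos)

lemma avg_vec_in_c00: "g \<in> avg_block A \<Longrightarrow> avg_vec g \<in> c00"
  by (cases g) (auto simp: c00_def supp_avg_vec, auto simp: avg_block_def)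

lemma act_avg_vec:
  assumes "(j, B) \<in> avg_block A" "\<And>k. k \<in> B \<Longrightarrow> \<phi> k = \<epsilon> / (real (m_seq (2 * j - 1)))\<^sup>2"
  shows "act \<phi> (avg_vec (j, B)) = \<epsilon>"
proof -
  have "act \<phi> (avg_vec (j, B)) = (\<Sum>k\<in>B. \<epsilon> / card B)"
    unfolding act_def supp_avg_vec[OF assms(1)]
    using assms(2) m_seq_pos[of "2 * j - 1"] by (intro sum.cong) (auto simp: avg_vec_def)
  moreover have "card B \<noteq> 0" using assms(1) n_seq_pos[of "2 * j - 1"] by (simp add: avg_block_def)
  ultimately show ?thesis by simp
qed

text \<open>Each common coordinate contributes \<open>?r\<close>, and the overlap has at most
  \<open>n j\<close> and at most \<open>n k\<close> points. For \<open>j \<le> k\<close> the first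
  count leaves the square of \<open>m j / m k\<close>; for \<open>k < j\<close> the second, with
  \<open>m j ^ 3 * n k \<le> n j\<close>, leaves at most \<open>1 / m j\<close>.\<close>

lemma abs_act_avg_vec_le:
  assumes g: "(j, B) \<in> avg_block A" and k: "1 \<le> k" and f: "f \<in> G1_at k"
  shows "\<bar>act f (avg_vec (j, B))\<bar> \<le> (1/2) ^ (if j \<le> k then k - j else j - k)"
proof -
  define m n where "m = (\<lambda>i. real (m_seq (2 * i - 1)))" and "n = (\<lambda>i. real (n_seq (2 * i - 1)))"
  have pos: "0 < m i" "0 < n i" for i by (simp_all add: m_def n_def m_seq_pos n_seq_pos)
  have m1: "1 \<le> m i" for i using m_seq_pos[of "2 * i - 1"] by (simp add: m_def)
  have B: "finite B" "real (card B) = n j" "1 \<le> j" using g by (auto simp: avg_block_def n_def)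
  have fk: "finite (supp f)" "card (supp f) \<le> n k" "\<And>i. i \<in> supp f \<Longrightarrow> \<bar>f i\<bar> = 1 / (m k)\<^sup>2"
    using f by (rule G1_at_cases; simp add: n_def m_def)+
  let ?r = "(m j)\<^sup>2 / ((m k)\<^sup>2 * n j)"
  have "\<bar>act f (avg_vec (j, B))\<bar> \<le> (\<Sum>i\<in>B. \<bar>f i * avg_vec (j, B) i\<bar>)"
    unfolding act_def supp_avg_vec[OF g] by (rule sum_abs)
  also have "\<dots> = (\<Sum>i\<in>B \<inter> supp f. \<bar>f i * avg_vec (j, B) i\<bar>)"
    using B by (intro sum.mono_neutral_right) (auto simp: supp_def)
  also have "\<dots> = (\<Sum>i\<in>B \<inter> supp f. ?r)"
    using fk(3) B(2) by (intro sum.cong) (auto simp: avg_vec_def abs_mult m_def)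
  also have "\<dots> = card (B \<inter> supp f) * ?r" by simp
  finally have le: "\<bar>act f (avg_vec (j, B))\<bar> \<le> card (B \<inter> supp f) * ?r" .
  have "card (B \<inter> supp f) \<le> card B" "card (B \<inter> supp f) \<le> card (supp f)"
    using B(1) fk(1) by (auto intro: card_mono)
  then have card: "card (B \<inter> supp f) \<le> n j" "card (B \<inter> supp f) \<le> n k"
    using B(2) fk(2) by linarith+
  show ?thesis
  proof (cases "j \<le> k")
    case True
    have "2 ^ (k - j) * m_seq (2 * j - 1) \<le> 2 ^ (2 * (k - j)) * m_seq (2 * j - 1)"
      by (intro mult_le_mono1 power_increasing) auto
    also have "\<dots> \<le> m_seq (2 * j - 1 + 2 * (k - j))" by (rule m_seq_growth)
    also have "2 * j - 1 + 2 * (k - j) = 2 * k - 1" using True B(3) by simp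
    finally have "real (2 ^ (k - j) * m_seq (2 * j - 1)) \<le> m k" unfolding m_def of_nat_le_iff .
    then have mjk: "2 ^ (k - j) * m j \<le> m k" by (simp add: m_def)
    have "card (B \<inter> supp f) * ?r \<le> n j * ?r"
      using card(1) pos[of j] by (intro mult_right_mono) auto
    also have "\<dots> = (m j / m k)\<^sup>2" using pos[of j] by (simp add: power_divide)
    also have "\<dots> \<le> m j / m k"
    proof -
      have "1 * m j \<le> 2 ^ (k - j) * m j"
        using pos[of j] by (intro mult_right_mono) (auto intro: less_imp_le)
      then have "m j / m k \<le> 1" using mjk pos[of k] by simp
      then show ?thesis
        unfolding power2_eq_square using pos[of j] pos[of k] by (intro mult_left_le_one_le) simp_all
    qed
    also have "\<dots> \<le> (1/2) ^ (k - j)"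
      using mjk pos[of k] by (simp add: field_simps power_one_over)
    finally show ?thesis using le True by simp
  next
    case False
    have "m_seq (2 * j - 1) ^ 3 * n_seq (2 * k - 1) \<le> n_seq (2 * j - 1)"
      using False k by (intro n_seq_mult_le) auto
    then have "real (m_seq (2 * j - 1) ^ 3 * n_seq (2 * k - 1)) \<le> n j" unfolding n_def of_nat_le_iff .
    then have nkj: "m j ^ 3 * n k \<le> n j" by (simp add: m_def n_def)
    have "2 ^ (j - k) \<le> (2::nat) ^ (2 * j - 1)" using False k by (intro power_increasing) auto
    also have "\<dots> \<le> m_seq (2 * j - 1)" by (rule two_power_le_m_seq)
    finally have "real (2 ^ (j - k)) \<le> m j" unfolding m_def of_nat_le_iff .
    then have mj: "2 ^ (j - k) \<le> m j" by simp
    have "card (B \<inter> supp f) * ?r \<le> n k * ?r"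
      using card(2) pos[of j] by (intro mult_right_mono) auto
    also have "\<dots> \<le> n k * ((m j)\<^sup>2 / n j)"
      using pos[of k] pos[of j] m1[of k]
      by (intro mult_left_mono divide_left_mono) (auto simp: mult_le_cancel_right1 one_le_power)
    also have "\<dots> \<le> 1 / m j"
    proof -
      have "m j * (n k * (m j)\<^sup>2) \<le> n j"
        using nkj by (simp add: power2_eq_square power3_eq_cube mult_ac)
      then show ?thesis using pos[of j] by (simp add: field_simps)
    qed
    also have "\<dots> \<le> 1 / 2 ^ (j - k)" using mj pos[of j] by (intro divide_left_mono) auto
    finally show ?thesis using le False by (simp add: power_one_over)
  qed
qed

text \<open>On either side of j the distances are distinct, so each side is part of a geometric
  series with sum 2.\<close>

lemma sum_half_powers_dist_le:
  assumes "finite K"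
  shows "(\<Sum>k\<in>K. (1/2::real) ^ (if j \<le> k then k - j else j - k)) \<le> 4"
proof -
  let ?A = "{k \<in> K. j \<le> k}" and ?B = "{k \<in> K. \<not> j \<le> k}"
  have "(\<Sum>k\<in>K. (1/2::real) ^ (if j \<le> k then k - j else j - k)) =
      (\<Sum>k\<in>K. if j \<le> k then (1/2) ^ (k - j) else (1/2) ^ (j - k))"
    by (intro sum.cong) auto
  also have "\<dots> = (\<Sum>k\<in>?A. (1/2) ^ (k - j)) + (\<Sum>k\<in>?B. (1/2) ^ (j - k))"
    using assms by (simp add: sum.If_cases Int_def)
  also have "(\<Sum>k\<in>?A. (1/2::real) ^ (k - j)) = sum ((^) (1/2)) ((\<lambda>k. k - j) ` ?A)"
    by (subst sum.reindex) (auto simp: inj_on_def)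
  also have "\<dots> \<le> 2" using assms by (intro sum_half_powers_le) auto
  also have "(\<Sum>k\<in>?B. (1/2::real) ^ (j - k)) = sum ((^) (1/2)) ((\<lambda>k. j - k) ` ?B)"
    by (subst sum.reindex) (auto simp: inj_on_def)
  also have "\<dots> \<le> 2" using assms by (intro sum_half_powers_le) auto
  finally show ?thesis by simp
qed

lemma abs_avg_vec_le:
  assumes "(j, B) \<in> avg_block A"
  shows "\<bar>avg_vec (j, B) i\<bar> \<le> 16"
proof -
  define m n where "m = m_seq (2 * j - 1)" and "n = n_seq (2 * j - 1)"
  have B: "1 \<le> j" "card B = n" using assms by (auto simp: avg_block_def n_def)
  \<comment> \<open>For \<open>j = 1\<close> both sides are \<open>2 ^ 10\<close>; for larger j the
    cubic growth gives even \<open>m ^ 2 \<le> n\<close>.\<close>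
  have "m ^ 2 \<le> 16 * n"
  proof (cases "j = 1")
    case False
    then have "m ^ 3 * n_seq 1 \<le> n" unfolding m_def n_def using B by (intro n_seq_mult_le) auto
    moreover have "m ^ 2 \<le> m ^ 3"
      using m_seq_pos by (intro power_increasing) (auto simp: m_def Suc_le_eq)
    ultimately show ?thesis by simp
  qed (simp add: m_def n_def)
  then have "real (m ^ 2) \<le> real (16 * n)" by (simp only: of_nat_le_iff)
  then have "(real m)\<^sup>2 / real n \<le> 16" using n_seq_pos by (simp add: n_def field_simps)
  then show ?thesis by (simp add: avg_vec_def B(2) m_def)
qed

text \<open>The constant is \<open>16 = m\<^sub>1\<^sup>2 / n\<^sub>1\<close>, attained by the coordinate functionals at \<open>j = 1\<close>.\<close>
lemma G_norm_avg_vec_le: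
  assumes "g \<in> avg_block A"
  shows "G_norm (G_set S M1 \<sigma>) (avg_vec g) \<le> 16"
proof -
  obtain j B where g: "g = (j, B)" by (cases g)
  have B: "(j, B) \<in> avg_block A" using assms g by simp
  show ?thesis unfolding g
  proof (rule G_norm_le, rule G_set_bound[where c = "\<lambda>k. (1/2) ^ (if j \<le> k then k - j else j - k)"])
    show "finite (supp (avg_vec (j, B)))" using avg_vec_in_c00[OF B] by (simp add: c00_def)
    show "(\<Sum>k\<in>K. (1/2::real) ^ (if j \<le> k then k - j else j - k)) \<le> 16" if "finite K" for K
      using sum_half_powers_dist_le[OF that, of j] by simp
  qed (rule abs_act_avg_vec_le[OF B] abs_avg_vec_le[OF B] zero_le_power; simp)+
qed

lemma one_le_G_norm_avg_vec:
  assumes "g \<in> avg_block A"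
  shows "1 \<le> G_norm (G_set S M1 \<sigma>) (avg_vec g)"
proof -
  obtain j B where g: "g = (j, B)" by (cases g)
  have B: "(j, B) \<in> avg_block A" using assms g by simp
  have "avg_fun g \<in> G_set S M1 \<sigma>"
    using avg_fun_in_G1_at[OF B] B unfolding g G_set_def G1_def avg_block_def by auto
  moreover have "act (avg_fun g) (avg_vec g) = 1"
    unfolding g by (rule act_avg_vec[OF B]) (simp add: avg_fun_def)
  ultimately show ?thesis using act_le_G_norm[OF avg_vec_in_c00[OF assms]] by metis
qed

section \<open>Special branches\<close>

text \<open>By \<open>supp_avg_fun\<close> this is the least point of the support of
  \<open>avg_fun g\<close>, the number tested by the Schreier condition on special
  sequences.\<close>

definition lab :: "nat \<times> nat set \<Rightarrow> nat" where
  "lab g = Min (snd g)"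

abbreviation precedes :: "nat \<times> nat set \<Rightarrow> nat \<times> nat set \<Rightarrow> bool" where
  "precedes g h \<equiv> fst g < fst h \<and> (\<forall>a\<in>snd g. \<forall>b\<in>snd h. a < b)"

lemma avg_blockD:
  assumes "g \<in> avg_block A"
  shows "1 \<le> fst g" "snd g \<subseteq> A" "snd g \<subseteq> {1..}" "finite (snd g)" "snd g \<noteq> {}"
  using assms avg_block_nonempty[of "fst g" "snd g" A] by (auto simp: avg_block_def)

lemma lab_in: "g \<in> avg_block A \<Longrightarrow> lab g \<in> snd g"
  unfolding lab_def using avg_blockD(4,5) by (rule Min_in)

lemma sorted_lab:
  assumes "set gs \<subseteq> avg_block A" "sorted_wrt precedes gs"
  shows "sorted_wrt (<) (map lab gs)"
  unfolding sorted_wrt_map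
  by (rule sorted_wrt_mono_rel[OF _ assms(2)]) (use assms(1) lab_in in blast)

lemma map_avg_fun_in_U_seqs:
  assumes "gs \<noteq> []" "set gs \<subseteq> avg_block A" "sorted_wrt precedes gs"
  shows "map avg_fun gs \<in> U_seqs"
proof -
  have "sorted_wrt before (map avg_fun gs)"
    unfolding sorted_wrt_map
  proof (rule sorted_wrt_mono_rel[OF _ assms(3)])
    fix g h assume "g \<in> set gs" "h \<in> set gs" and p: "precedes g h"
    then have "g \<in> avg_block A" "h \<in> avg_block A" using assms(2) by auto
    then have "Max (snd g) \<in> snd g" "Min (snd h) \<in> snd h"
      using avg_blockD(4,5) by (auto intro!: Max_in Min_in)
    moreover have "supp (avg_fun g) = snd g" "supp (avg_fun h) = snd h"
      using supp_avg_fun by (metis prod.collapse)+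
    ultimately show "before (avg_fun g) (avg_fun h)" using p by (simp add: before_def)
  qed
  moreover have "sorted_wrt (<) (map fst gs)"
    unfolding sorted_wrt_map by (rule sorted_wrt_mono_rel[OF _ assms(3)]) blast
  moreover have "1 \<le> fst (gs ! i) \<and> avg_fun (gs ! i) \<in> G1_at (fst (gs ! i))" if "i < length gs" for i
  proof -
    have "gs ! i \<in> avg_block A" using assms(2) that nth_mem by blast
    then show ?thesis
      using avg_fun_in_G1_at[of "fst (gs ! i)" "snd (gs ! i)" A] avg_blockD(1) by simp
  qed
  ultimately show ?thesis
    unfolding U_seqs_def using assms(1)
    by (intro CollectI conjI exI[of _ "map fst gs"]) auto
qed

section \<open>Branches that obey the coding\<close>

locale coded_averages =
  fixes M1 M2 M :: "nat set" and \<sigma> :: "(nat \<Rightarrow> real) list \<Rightarrow> nat"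
  assumes coding: "coding M1 M2 \<sigma>" and M_pos: "M \<subseteq> {1..}" and infinite_M: "infinite M"
begin

definition start :: nat where
  "start = (LEAST n. n \<in> M)"

lemma start_in: "start \<in> M"
  unfolding start_def using infinite_M LeastI_ex[of "\<lambda>n. n \<in> M"] by (metis ex_in_conv finite.emptyI)

text \<open>Blocks lie beyond the first point of M, whose basis vector heads every node, so that its
  support is disjoint from those of the averages.\<close>

abbreviation blocks :: "(nat \<times> nat set) set" where
  "blocks \<equiv> avg_block (M \<inter> {start<..})"

text \<open>
  The coding only makes \<open>\<sigma>\<close> increase along extensions, so \<open>\<sigma>(f\<^sub>1) > ind f\<^sub>1\<close> has to be
  demanded separately; it can be achieved because \<open>\<sigma>\<close> is injective.
\<close>
inductive branch :: "(nat \<times> nat set) list \<Rightarrow> bool" where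
  Nil: "branch []"
| snoc: "branch gs \<Longrightarrow> g \<in> blocks \<Longrightarrow> \<forall>h\<in>set gs. precedes h g \<Longrightarrow>
    fst g \<in> (if gs = [] then M1 else {\<sigma> (map avg_fun gs)}) \<Longrightarrow>
    fst g < \<sigma> (map avg_fun (gs @ [g])) \<Longrightarrow> branch (gs @ [g])"

lemma branch_prefix: "branch (gs @ hs) \<Longrightarrow> branch gs"
proof (induction hs rule: rev_induct)
  case (snoc h hs)
  from snoc.prems have "branch (gs @ hs)" by (cases rule: branch.cases) auto
  then show ?case by (rule snoc.IH)
qed simp

lemma branch_blocks: "branch gs \<Longrightarrow> set gs \<subseteq> blocks"
  by (induction rule: branch.induct) auto

lemma branch_sorted: "branch gs \<Longrightarrow> sorted_wrt precedes gs"
  by (induction rule: branch.induct) (auto simp: sorted_wrt_append)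

lemma branch_in_U_seqs: "branch gs \<Longrightarrow> gs \<noteq> [] \<Longrightarrow> map avg_fun gs \<in> U_seqs"
  using map_avg_fun_in_U_seqs branch_blocks branch_sorted by blast

text \<open>The code of a nonempty branch is the index of its next entry, so this keeps indices
  strictly increasing under extension.\<close>

lemma branch_fst_less: "branch gs \<Longrightarrow> \<forall>h\<in>set gs. fst h < \<sigma> (map avg_fun gs)"
  by (induction rule: branch.induct) (auto intro: less_trans)

lemma branch_first: "branch gs \<Longrightarrow> gs \<noteq> [] \<Longrightarrow> fst (gs ! 0) \<in> M1"
  by (induction rule: branch.induct) (auto simp: nth_append split: if_splits)

lemma branch_next:
  "branch gs \<Longrightarrow> Suc i < length gs \<Longrightarrow> fst (gs ! Suc i) = \<sigma> (map avg_fun (take (Suc i) gs))"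
proof (induction rule: branch.induct)
  case (snoc gs g)
  show ?case
  proof (cases "Suc i = length gs")
    case True
    then show ?thesis using snoc.hyps(4) by (auto simp: nth_append split: if_splits)
  next
    case False
    then show ?thesis using snoc.IH snoc.prems by (simp add: nth_append)
  qed
qed simp

lemma branch_lab_sorted: "branch gs \<Longrightarrow> sorted_wrt (<) (map lab gs)"
  using sorted_lab branch_blocks branch_sorted by blast

text \<open>Branches have every property of special sequences built in except the Schreier
  condition. That one is a separate hypothesis, so branches can be extended without end.\<close>

lemma branch_special:
  assumes "branch gs" "gs \<noteq> []" "lab ` set gs \<in> S"
  shows "map avg_fun gs \<in> special_seqs S M1 \<sigma>"
proof -
  have G1: "avg_fun (gs ! i) \<in> G1_at (fst (gs ! i))" if "i < length gs" for i
  proof -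
    have "gs ! i \<in> blocks" using branch_blocks[OF assms(1)] that nth_mem by blast
    then show ?thesis using avg_fun_in_G1_at[of "fst (gs ! i)" "snd (gs ! i)"] by simp
  qed
  have "supp (avg_fun g) = snd g" for g using supp_avg_fun by (metis prod.collapse)
  then have "(\<lambda>f. Min (supp f)) ` set (map avg_fun gs) = lab ` set gs"
    by (simp add: image_image lab_def)
  moreover have "\<exists>j\<in>M1. map avg_fun gs ! 0 \<in> G1_at j"
    using branch_first[OF assms(1,2)] G1[of 0] assms(2) by auto
  moreover have "map avg_fun gs ! Suc i \<in> G1_at (\<sigma> (take (Suc i) (map avg_fun gs)))"
    if "Suc i < length (map avg_fun gs)" for i
    using that G1[of "Suc i"] branch_next[OF assms(1), of i] by (simp add: take_map)
  ultimately show ?thesis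
    unfolding special_seqs_def using branch_in_U_seqs[OF assms(1,2)] assms(3) by simp
qed

lemma ex_block:
  assumes "1 \<le> j"
  obtains B where "(j, B) \<in> blocks" "\<forall>b\<in>B. N < b"
proof -
  have "infinite (M \<inter> {max N start<..})"
  proof
    assume "finite (M \<inter> {max N start<..})"
    then have "finite ((M \<inter> {max N start<..}) \<union> {..max N start})" by simp
    moreover have "M \<subseteq> (M \<inter> {max N start<..}) \<union> {..max N start}" by auto
    ultimately show False using infinite_M finite_subset by blast
  qed
  then obtain B where "finite B" "card B = n_seq (2 * j - 1)" "B \<subseteq> M \<inter> {max N start<..}"
    by (metis infinite_arbitrarily_large)
  then have "(j, B) \<in> blocks" "\<forall>b\<in>B. N < b"
    using assms M_pos by (auto simp: avg_block_def)
  then show thesis by (rule that)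
qed

text \<open>There are infinitely many blocks beyond N, and \<sigma> is injective on the
  corresponding one-term sequences, so some code exceeds j.\<close>

lemma ex_block_code:
  assumes "1 \<le> j"
  obtains B where "(j, B) \<in> blocks" "\<forall>b\<in>B. N < b" "j < \<sigma> [avg_fun (j, B)]"
proof -
  let ?\<B> = "{B. (j, B) \<in> blocks \<and> (\<forall>b\<in>B. N < b)}"
  have "infinite ?\<B>"
  proof
    assume fin: "finite ?\<B>"
    then have "finite (\<Union>?\<B>)" by (auto simp: avg_block_def)
    then obtain K where K: "\<And>b. b \<in> \<Union>?\<B> \<Longrightarrow> b \<le> K" by (meson finite_nat_set_iff_bounded_le)
    obtain B where B: "(j, B) \<in> blocks" "\<forall>b\<in>B. max N K < b" using ex_block[OF assms] by blast
    then obtain b where "b \<in> B" using avg_block_nonempty by blast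
    moreover have "B \<in> ?\<B>" using B by auto
    ultimately have "b \<le> K" "K < b" using B(2) by (blast intro: K, simp)
    then show False by simp
  qed
  moreover have "inj_on (\<lambda>B. \<sigma> [avg_fun (j, B)]) ?\<B>"
  proof (rule inj_onI)
    fix B C assume B: "B \<in> ?\<B>" and C: "C \<in> ?\<B>" and eq: "\<sigma> [avg_fun (j, B)] = \<sigma> [avg_fun (j, C)]"
    have "[avg_fun (j, D)] \<in> U_seqs" if "D \<in> ?\<B>" for D
      using map_avg_fun_in_U_seqs[of "[(j, D)]"] that by auto
    then have "[avg_fun (j, B)] = [avg_fun (j, C)]"
      using coding eq B C unfolding coding_def by (meson inj_onD)
    then show "B = C" by (metis list.inject supp_avg_fun)
  qed
  ultimately have "infinite ((\<lambda>B. \<sigma> [avg_fun (j, B)]) ` ?\<B>)" by (simp add: finite_image_iff)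
  then have "\<not> (\<lambda>B. \<sigma> [avg_fun (j, B)]) ` ?\<B> \<subseteq> {..j}" using finite_subset by blast
  then obtain B where "B \<in> ?\<B>" "\<sigma> [avg_fun (j, B)] \<notin> {..j}" by (meson image_subsetI)
  then show thesis using that[of B] by (simp add: not_le)
qed

text \<open>A first entry comes from \<open>M1\<close> and \<open>ex_block_code\<close>. Later the
  index is forced to be the code, and monotonicity of \<sigma> along extensions keeps the next code
  above it; only the block is free, and it can be moved past N and all earlier blocks.\<close>

lemma branch_extend:
  assumes "branch gs"
  shows "\<exists>g. branch (gs @ [g]) \<and> N \<le> lab g"
proof (cases "gs = []")
  case True
  obtain j where j: "j \<in> M1" using coding unfolding coding_def by (metis ex_in_conv finite.emptyI)
  then have "1 \<le> j" using coding unfolding coding_def by auto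
  then obtain B where B: "(j, B) \<in> blocks" "\<forall>b\<in>B. N < b" "j < \<sigma> [avg_fun (j, B)]"
    by (rule ex_block_code)
  have "branch ([] @ [(j, B)])" using B j by (intro branch.snoc branch.Nil) auto
  moreover have "N < lab (j, B)" using lab_in[OF B(1)] B(2) by simp
  ultimately show ?thesis using True by (metis less_imp_le)
next
  case False
  let ?j = "\<sigma> (map avg_fun gs)"
  have U: "map avg_fun gs \<in> U_seqs" using branch_in_U_seqs assms False by blast
  then have "?j \<in> M2" "M2 \<subseteq> {1..}" using coding unfolding coding_def by auto
  then have j: "1 \<le> ?j" by auto
  have "finite (\<Union>(snd ` set gs))" using branch_blocks[OF assms] avg_blockD(4) by blast
  then obtain K where K: "\<And>a. a \<in> \<Union>(snd ` set gs) \<Longrightarrow> a \<le> K"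
    by (meson finite_nat_set_iff_bounded_le)
  obtain B where B: "(?j, B) \<in> blocks" "\<forall>b\<in>B. max N K < b" using ex_block[OF j] by blast
  have prec: "\<forall>h\<in>set gs. precedes h (?j, B)"
    using K B(2) branch_fst_less[OF assms] by fastforce
  have "map avg_fun (gs @ [(?j, B)]) \<in> U_seqs"
    using branch_blocks[OF assms] branch_sorted[OF assms] B(1) prec
    by (intro map_avg_fun_in_U_seqs[where A = "M \<inter> {start<..}"]) (auto simp: sorted_wrt_append)
  then have "?j < \<sigma> (map avg_fun (gs @ [(?j, B)]))"
    using U coding unfolding coding_def by simp
  then have "branch (gs @ [(?j, B)])"
    using False B(1) prec by (intro branch.snoc assms) auto
  moreover have "N < lab (?j, B)" using lab_in[OF B(1)] B(2) by simp
  ultimately show ?thesis by (metis less_imp_le)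
qed

end

section \<open>The tree of averages\<close>

lemma supp_sum_subset: "supp (\<lambda>k. \<Sum>i\<in>I. a i * x i k) \<subseteq> (\<Union>i\<in>I. supp (x i))"
proof
  fix k assume "k \<in> supp (\<lambda>k. \<Sum>i\<in>I. a i * x i k)"
  then have "(\<Sum>i\<in>I. a i * x i k) \<noteq> 0" by (simp add: supp_def)
  then obtain i where "i \<in> I" "a i * x i k \<noteq> 0" by (rule sum.not_neutral_contains_not_neutral)
  then show "k \<in> (\<Union>i\<in>I. supp (x i))" by (auto simp: supp_def)
qed

lemma sum_in_c00:
  assumes "finite I" "\<And>i. i \<in> I \<Longrightarrow> x i \<in> c00"
  shows "(\<lambda>k. \<Sum>i\<in>I. a i * x i k) \<in> c00"
proof -
  have "finite (\<Union>i\<in>I. supp (x i))" "(\<Union>i\<in>I. supp (x i)) \<subseteq> {1..}"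
    using assms by (auto simp: c00_def)
  then show ?thesis using supp_sum_subset[of a x I] unfolding c00_def
    by (blast intro: finite_subset)
qed

lemma scale_in_c00: "x \<in> c00 \<Longrightarrow> (\<lambda>k. c * x k) \<in> c00"
  using sum_in_c00[of "{0::nat}" "\<lambda>_. x" "\<lambda>_. c"] by simp

lemma act_sum_right:
  assumes "finite I" "\<And>i. i \<in> I \<Longrightarrow> x i \<in> c00"
  shows "act f (\<lambda>k. \<Sum>i\<in>I. a i * x i k) = (\<Sum>i\<in>I. a i * act f (x i))"
proof -
  let ?A = "\<Union>i\<in>I. supp (x i)"
  have fin: "finite ?A" using assms by (auto simp: c00_def)
  have "act f (\<lambda>k. \<Sum>i\<in>I. a i * x i k) = (\<Sum>k\<in>?A. \<Sum>i\<in>I. a i * (f k * x i k))"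
    using act_eq_sum[OF fin supp_sum_subset] by (simp add: sum_distrib_left mult.left_commute)
  also have "\<dots> = (\<Sum>i\<in>I. \<Sum>k\<in>?A. a i * (f k * x i k))" by (rule sum.swap)
  also have "\<dots> = (\<Sum>i\<in>I. a i * act f (x i))"
  proof (rule sum.cong)
    fix i assume "i \<in> I"
    then have "act f (x i) = (\<Sum>k\<in>?A. f k * x i k)" using fin by (intro act_eq_sum) auto
    then show "(\<Sum>k\<in>?A. a i * (f k * x i k)) = a i * act f (x i)" by (simp add: sum_distrib_left)
  qed simp
  finally show ?thesis .
qed

lemma act_scale_right: "x \<in> c00 \<Longrightarrow> act f (\<lambda>k. c * x k) = c * act f x"
  using act_sum_right[of "{0::nat}" "\<lambda>_. x" f "\<lambda>_. c"] by simp

lemma supp_unit_vec: "supp (unit_vec n) = {n}"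
  by (auto simp: supp_def unit_vec_def)

lemma unit_vec_in_c00: "1 \<le> n \<Longrightarrow> unit_vec n \<in> c00"
  by (simp add: c00_def supp_unit_vec)

section \<open>The averages inside the completion\<close>

locale coded_completion = coded_averages +
  fixes S :: "nat set set" and \<iota> :: "(nat \<Rightarrow> real) \<Rightarrow> 'a::banach"
  assumes completion: "is_completion (G_norm (G_set S M1 \<sigma>)) \<iota>"
begin

abbreviation N :: "(nat \<Rightarrow> real) \<Rightarrow> real" where
  "N \<equiv> G_norm (G_set S M1 \<sigma>)"

lemma \<iota>_scale: "x \<in> c00 \<Longrightarrow> \<iota> (\<lambda>k. c * x k) = c *\<^sub>R \<iota> x"
  using completion unfolding is_completion_def by blast

lemma \<iota>_add: "x \<in> c00 \<Longrightarrow> y \<in> c00 \<Longrightarrow> \<iota> (\<lambda>k. x k + y k) = \<iota> x + \<iota> y"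
  using completion unfolding is_completion_def by blast

lemma norm_\<iota>: "x \<in> c00 \<Longrightarrow> norm (\<iota> x) = N x"
  using completion unfolding is_completion_def by blast

lemma \<iota>_sum:
  assumes "finite I" "\<And>i. i \<in> I \<Longrightarrow> x i \<in> c00"
  shows "\<iota> (\<lambda>k. \<Sum>i\<in>I. a i * x i k) = (\<Sum>i\<in>I. a i *\<^sub>R \<iota> (x i))"
  using assms
proof (induction I rule: finite_induct)
  case empty
  have "(\<lambda>k. 0) \<in> c00" by (simp add: c00_def supp_def)
  from \<iota>_scale[OF this, of 0] show ?case by simp
next
  case (insert i I)
  then have "\<iota> (\<lambda>k. a i * x i k + (\<Sum>i\<in>I. a i * x i k)) =
      \<iota> (\<lambda>k. a i * x i k) + \<iota> (\<lambda>k. \<Sum>i\<in>I. a i * x i k)"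
    by (intro \<iota>_add scale_in_c00 sum_in_c00) auto
  then show ?case using insert by (simp add: \<iota>_scale)
qed

text \<open>The norm dominates coordinates. This permits reading supports, hence labels, off the
  vectors of a node.\<close>

lemma \<iota>_inject:
  assumes "x \<in> c00" "y \<in> c00" "\<iota> x = \<iota> y"
  shows "x = y"
proof
  fix n
  let ?z = "\<lambda>k. x k + (-1) * y k"
  have "\<iota> ?z = \<iota> x + (-1) *\<^sub>R \<iota> y"
    using assms by (simp only: \<iota>_add scale_in_c00 \<iota>_scale)
  then have "\<iota> ?z = 0" using assms(3) by simp
  moreover have z: "?z \<in> c00"
    using sum_in_c00[of UNIV "\<lambda>b. if b then x else y" "\<lambda>b. if b then 1 else -1"] assms
    by (simp add: UNIV_bool add.commute)
  ultimately have "N ?z = 0" using norm_\<iota> by fastforce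
  then show "x n = y n" using abs_coord_le_G_norm[OF z, of n S M1 \<sigma>] by simp
qed

definition unit_avg :: "nat \<times> nat set \<Rightarrow> nat \<Rightarrow> real" where
  "unit_avg g = (\<lambda>k. (1 / N (avg_vec g)) * avg_vec g k)"

text \<open>The lower bound allows division by the norm; the upper one is the factor lost when the
  averages are normalized.\<close>

lemma N_avg_vec: "g \<in> blocks \<Longrightarrow> 1 \<le> N (avg_vec g) \<and> N (avg_vec g) \<le> 16"
  by (simp add: one_le_G_norm_avg_vec G_norm_avg_vec_le)

lemma unit_avg_in_c00: "g \<in> blocks \<Longrightarrow> unit_avg g \<in> c00"
  unfolding unit_avg_def by (intro scale_in_c00 avg_vec_in_c00)

lemma supp_unit_avg:
  assumes "g \<in> blocks"
  shows "supp (unit_avg g) = snd g"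
proof -
  have "supp (unit_avg g) = supp (avg_vec g)"
    using N_avg_vec[OF assms] by (auto simp: supp_def unit_avg_def)
  then show ?thesis using assms supp_avg_vec by (metis prod.collapse)
qed

lemma norm_\<iota>_unit_avg:
  assumes "g \<in> blocks"
  shows "norm (\<iota> (unit_avg g)) = 1"
  unfolding unit_avg_def
  using N_avg_vec[OF assms]
  by (simp only: \<iota>_scale[OF avg_vec_in_c00[OF assms]] norm_scaleR
      norm_\<iota>[OF avg_vec_in_c00[OF assms]]) simp

lemma start_pos: "1 \<le> start"
  using start_in M_pos by auto

lemma norm_\<iota>_start: "norm (\<iota> (unit_vec start)) = 1"
proof -
  note e = unit_vec_in_c00[OF start_pos]
  have "(\<Sum>i\<in>supp (unit_vec start). \<bar>unit_vec start i\<bar>) = 1"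
    unfolding supp_unit_vec by (simp add: unit_vec_def)
  then have "N (unit_vec start) \<le> 1" using G_set_bound_l1[OF e] by (metis G_norm_le)
  moreover have "1 \<le> N (unit_vec start)"
    using abs_coord_le_G_norm[OF e, of start] by (simp add: unit_vec_def)
  ultimately show ?thesis using norm_\<iota>[OF e] by simp
qed

lemma \<iota>_in_span:
  assumes "x \<in> c00" "supp x \<subseteq> M"
  shows "\<iota> x \<in> span {\<iota> (unit_vec n) | n. n \<in> M}"
proof -
  have fin: "finite (supp x)" using assms(1) by (simp add: c00_def)
  have "x = (\<lambda>k. \<Sum>i\<in>supp x. x i * unit_vec i k)"
  proof
    fix k
    have "(\<Sum>i\<in>supp x. x i * unit_vec i k) = (\<Sum>i\<in>supp x. if k = i then x i else 0)"
      by (intro sum.cong) (auto simp: unit_vec_def)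
    also have "\<dots> = x k" using fin by (simp add: supp_def)
    finally show "x k = (\<Sum>i\<in>supp x. x i * unit_vec i k)" ..
  qed
  then have "\<iota> x = \<iota> (\<lambda>k. \<Sum>i\<in>supp x. x i * unit_vec i k)" by simp
  also have "\<dots> = (\<Sum>i\<in>supp x. x i *\<^sub>R \<iota> (unit_vec i))"
    using fin assms(1) by (intro \<iota>_sum unit_vec_in_c00) (auto simp: c00_def)
  also have "\<dots> \<in> span {\<iota> (unit_vec n) | n. n \<in> M}"
    using assms(2) by (intro span_sum span_scale span_base) blast
  finally show ?thesis .
qed

section \<open>Nodes, their l1 estimate and well-foundedness\<close>

definition node :: "(nat \<times> nat set) list \<Rightarrow> 'a list" where
  "node gs = \<iota> (unit_vec start) # map (\<lambda>g. \<iota> (unit_avg g)) gs"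

text \<open>The empty branch takes part, as Schreier families contain the empty set; its node, the
  leading basis vector alone, is the root.\<close>

definition avg_tree :: "'a list set" where
  "avg_tree = {node gs | gs. branch gs \<and> lab ` set gs \<in> S}"

text \<open>
  The first vector of a node is seen by \<open>e\<^sub>p\<^sup>*\<close> with \<open>p\<close> the smallest element of \<open>M\<close>, the others
  by the special functional of the branch, which vanishes at \<open>p\<close>.
\<close>
lemma node_l1_lower:
  assumes gs: "branch gs" "lab ` set gs \<in> S"
  shows "(\<Sum>i<length (node gs). \<bar>a i\<bar>) \<le> 17 * norm (\<Sum>i<length (node gs). a i *\<^sub>R node gs ! i)"
proof -
  let ?n = "length gs" and ?e = "unit_vec start"
  \<comment> \<open>Position 0 holds the leading basis vector, so the averages are shifted by
    one.\<close>
  define u where "u i = (case i of 0 \<Rightarrow> ?e | Suc i \<Rightarrow> unit_avg (gs ! i))" for i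
  define w where "w = (\<lambda>k. \<Sum>i<Suc ?n. a i * u i k)"
  have B: "gs ! i \<in> blocks" if "i < ?n" for i
    using branch_blocks[OF gs(1)] that nth_mem by blast
  have u: "u i \<in> c00" if "i < Suc ?n" for i
    using that B unit_avg_in_c00 unit_vec_in_c00[OF start_pos]
    by (cases i) (auto simp: u_def)
  have nth: "node gs ! i = \<iota> (u i)" if "i < Suc ?n" for i
    using that by (cases i) (auto simp: u_def node_def)
  have w: "w \<in> c00" unfolding w_def using u by (intro sum_in_c00) auto
  have "\<iota> w = (\<Sum>i<Suc ?n. a i *\<^sub>R \<iota> (u i))" unfolding w_def using u by (intro \<iota>_sum) auto
  also have "\<dots> = (\<Sum>i<length (node gs). a i *\<^sub>R node gs ! i)"
    using nth by (intro sum.cong) (auto simp: node_def)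
  finally have norm_w: "norm (\<Sum>i<length (node gs). a i *\<^sub>R node gs ! i) = N w"
    using norm_\<iota>[OF w] by simp
  have start_notin: "start \<notin> snd (gs ! i)" if "i < ?n" for i
    using avg_blockD(2)[OF B[OF that]] by auto
  have "w start = a 0 + (\<Sum>i<?n. a (Suc i) * unit_avg (gs ! i) start)"
    unfolding w_def sum.lessThan_Suc_shift by (simp add: u_def unit_vec_def)
  also have "(\<Sum>i<?n. a (Suc i) * unit_avg (gs ! i) start) = 0"
    using start_notin supp_unit_avg[OF B] by (intro sum.neutral) (auto simp: supp_def)
  finally have lower0: "\<bar>a 0\<bar> \<le> N w" using abs_coord_le_G_norm[OF w, of start] by simp
  have lower1: "(\<Sum>i<?n. \<bar>a (Suc i)\<bar>) \<le> 16 * N w"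
  proof (cases "gs = []")
    case True
    then show ?thesis using lower0 by simp
  next
    case False
    \<comment> \<open>With signs matching the coefficients every average contributes a modulus; a
      zero coefficient gets sign 1, since \<open>Gsp_ind\<close> admits only 1 and -1.\<close>
    define \<epsilon> where "\<epsilon> i = (if a (Suc i) \<ge> 0 then 1 else -1 :: real)" for i
    define \<phi> where "\<phi> = signed_sum {1..} \<epsilon> (map avg_fun gs)"
    have "interval {1..}" by (auto simp: interval_def)
    then have "\<phi> \<in> Gsp S M1 \<sigma>"
      using branch_special[OF gs(1) False gs(2)]
      unfolding \<phi>_def Gsp_def Gsp_ind_def image_iff by (force simp: \<epsilon>_def)
    then have \<phi>_G: "\<phi> \<in> G_set S M1 \<sigma>" by (simp add: G_set_def)
    have \<phi>_eq: "\<phi> k = (\<Sum>l<?n. \<epsilon> l * avg_fun (gs ! l) k)" if "1 \<le> k" for k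
      using that by (simp add: \<phi>_def signed_sum_def restr_def)
    have zero: "avg_fun (gs ! l) k = 0" if "k \<notin> snd (gs ! l)" for l k
      using that supp_avg_fun[of "fst (gs ! l)" "snd (gs ! l)"] by (auto simp: supp_def)
    have "\<phi> start = 0"
      unfolding \<phi>_eq[OF start_pos] using zero[OF start_notin] by (intro sum.neutral) auto
    then have act0: "act \<phi> ?e = 0" by (simp add: act_def supp_unit_vec)
    have act1: "act \<phi> (unit_avg (gs ! i)) = \<epsilon> i / N (avg_vec (gs ! i))" if i: "i < ?n" for i
    proof -
      obtain j C where g: "gs ! i = (j, C)" by (cases "gs ! i")
      have "\<phi> k = \<epsilon> i / (real (m_seq (2 * j - 1)))\<^sup>2" if k: "k \<in> C" for k
      proof -
        have "1 \<le> k" using avg_blockD(3)[OF B[OF i]] g k by auto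
        \<comment> \<open>The blocks of a branch are disjoint, so only the i-th functional is
          nonzero at k.\<close>
        have "k \<notin> snd (gs ! l)" if "l < ?n" "l \<noteq> i" for l
          using branch_sorted[OF gs(1)] that i k g
          unfolding sorted_wrt_iff_nth_less by (metis less_irrefl linorder_neqE_nat snd_conv)
        then have "(\<Sum>l<?n. \<epsilon> l * avg_fun (gs ! l) k) = (\<Sum>l\<in>{i}. \<epsilon> l * avg_fun (gs ! l) k)"
          using i zero by (intro sum.mono_neutral_right) auto
        then show ?thesis using \<phi>_eq[OF \<open>1 \<le> k\<close>] k by (simp add: g avg_fun_def)
      qed
      then have "act \<phi> (avg_vec (gs ! i)) = \<epsilon> i"
        using B[OF i] unfolding g by (intro act_avg_vec)
      then show ?thesis
        unfolding unit_avg_def act_scale_right[OF avg_vec_in_c00[OF B[OF i]]] by simp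
    qed
    have "act \<phi> w = (\<Sum>i<Suc ?n. a i * act \<phi> (u i))"
      unfolding w_def using u by (intro act_sum_right) auto
    also have "\<dots> = (\<Sum>i<?n. a (Suc i) * act \<phi> (unit_avg (gs ! i)))"
      unfolding sum.lessThan_Suc_shift by (simp add: u_def act0)
    also have "\<dots> = (\<Sum>i<?n. \<bar>a (Suc i)\<bar> / N (avg_vec (gs ! i)))"
      by (intro sum.cong) (auto simp: act1 \<epsilon>_def)
    also have "\<dots> \<ge> (\<Sum>i<?n. \<bar>a (Suc i)\<bar> / 16)"
      using N_avg_vec[OF B] by (intro sum_mono divide_left_mono)
        (auto intro!: mult_pos_pos intro: less_le_trans[OF zero_less_one])
    finally have "(\<Sum>i<?n. \<bar>a (Suc i)\<bar>) / 16 \<le> act \<phi> w" by (simp add: sum_divide_distrib)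
    then show ?thesis using act_le_G_norm[OF w \<phi>_G] by simp
  qed
  \<comment> \<open>The constant 17 is 1 for the leading vector plus 16 for the normalized
    averages.\<close>
  have "(\<Sum>i<length (node gs). \<bar>a i\<bar>) = \<bar>a 0\<bar> + (\<Sum>i<?n. \<bar>a (Suc i)\<bar>)"
    unfolding node_def by (simp only: length_Cons length_map sum.lessThan_Suc_shift)
  also have "\<dots> \<le> 17 * N w" using lower0 lower1 by simp
  finally show ?thesis unfolding norm_w .
qed

lemma norm_node: "branch gs \<Longrightarrow> x \<in> set (node gs) \<Longrightarrow> norm x = 1"
  using branch_blocks norm_\<iota>_unit_avg norm_\<iota>_start by (auto simp: node_def)

lemma equiv_l1_basis_node:
  assumes "branch gs" "lab ` set gs \<in> S"
  shows "equiv_l1_basis 17 (node gs)"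
  unfolding equiv_l1_basis_def
\<comment> \<open>The lower constant is that of \<open>node_l1_lower\<close>; the upper one is 1 by
  the triangle inequality for unit vectors.\<close>
proof (rule exI[of _ 17], rule exI[of _ 1], intro conjI allI)
  fix a :: "nat \<Rightarrow> real"
  show "1 / 17 * (\<Sum>i<length (node gs). \<bar>a i\<bar>) \<le> norm (\<Sum>i<length (node gs). a i *\<^sub>R node gs ! i)"
    using node_l1_lower[OF assms, of a] by simp
  have "norm (\<Sum>i<length (node gs). a i *\<^sub>R node gs ! i) \<le> (\<Sum>i<length (node gs). \<bar>a i\<bar>)"
    using norm_node[OF assms(1)] by (intro sum_norm_le) simp
  then show "norm (\<Sum>i<length (node gs). a i *\<^sub>R node gs ! i) \<le> 1 * (\<Sum>i<length (node gs). \<bar>a i\<bar>)"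
    by simp
qed simp_all

lemma is_l1_tree_avg_tree:
  assumes her: "\<And>F G. F \<in> S \<Longrightarrow> G \<subseteq> F \<Longrightarrow> G \<in> S"
  shows "is_l1_tree 17 (closure (span {\<iota> (unit_vec n) | n. n \<in> M})) avg_tree"
  unfolding is_l1_tree_def
proof (intro conjI ballI)
  show "is_tree avg_tree"
    unfolding is_tree_def
  proof (intro conjI allI impI)
    show "[] \<notin> avg_tree" by (auto simp: avg_tree_def node_def)
    fix xs ys :: "'a list" assume xs: "xs \<noteq> [] \<and> xs @ ys \<in> avg_tree"
    then obtain gs where gs: "xs @ ys = node gs" "branch gs" "lab ` set gs \<in> S"
      by (auto simp: avg_tree_def)
    \<comment> \<open>The leading basis vector is not an entry of the branch, hence one entry
      fewer.\<close>
    let ?gs = "take (length xs - 1) gs"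
    have "xs = take (length xs) (node gs)" by (simp flip: gs(1))
    then have "xs = node ?gs" using xs by (cases xs) (auto simp: node_def take_map)
    moreover have "branch ?gs" using gs(2) branch_prefix by (metis append_take_drop_id)
    moreover have "lab ` set ?gs \<in> S" using gs(3) by (rule her) (auto dest: in_set_takeD)
    ultimately show "xs \<in> avg_tree" unfolding avg_tree_def by blast
  qed
  fix xs assume "xs \<in> avg_tree"
  then obtain gs where gs: "xs = node gs" "branch gs" "lab ` set gs \<in> S"
    by (auto simp: avg_tree_def)
  show "equiv_l1_basis 17 xs" using equiv_l1_basis_node gs by simp
  show "norm x = 1" if "x \<in> set xs" for x using norm_node gs that by simp
  have "\<iota> (unit_avg g) \<in> span {\<iota> (unit_vec n) | n. n \<in> M}" if "g \<in> set gs" for g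
  proof -
    have g: "g \<in> blocks" using branch_blocks[OF gs(2)] that by blast
    then show ?thesis
      using avg_blockD(2)[OF g] by (intro \<iota>_in_span unit_avg_in_c00) (auto simp: supp_unit_avg)
  qed
  moreover have "\<iota> (unit_vec start) \<in> span {\<iota> (unit_vec n) | n. n \<in> M}"
    using start_in by (intro span_base) blast
  ultimately have "set xs \<subseteq> span {\<iota> (unit_vec n) | n. n \<in> M}" by (auto simp: gs(1) node_def)
  then show "set xs \<subseteq> closure (span {\<iota> (unit_vec n) | n. n \<in> M})" using closure_subset by blast
qed

text \<open>An infinite branch of the tree would give a strictly increasing sequence of labels all
  of whose prefixes lie in S.\<close>

lemma well_founded_avg_tree:
  assumes chain: "\<And>p :: nat \<Rightarrow> nat. strict_mono p \<Longrightarrow> \<exists>k. p ` {..<k} \<notin> S"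
  shows "well_founded_tree avg_tree"
  unfolding well_founded_tree_def
proof
  assume "\<exists>x. \<forall>k. map x [0..<Suc k] \<in> avg_tree"
  then obtain x where "\<forall>k. map x [0..<Suc k] \<in> avg_tree" by blast
  then have "\<forall>k. \<exists>gs. map x [0..<Suc k] = node gs \<and> branch gs \<and> lab ` set gs \<in> S"
    by (auto simp: avg_tree_def)
  then obtain gs where gs: "\<And>k. map x [0..<Suc k] = node (gs k)" "\<And>k. branch (gs k)"
    "\<And>k. lab ` set (gs k) \<in> S" by metis
  have len: "length (gs k) = k" for k
    using arg_cong[OF gs(1), of length] by (simp add: node_def)
  have nth: "\<iota> (unit_avg (gs k ! i)) = x (Suc i)" if "i < k" for i k
  proof -
    have "node (gs k) ! Suc i = x (Suc i)"
      using that by (simp only: gs(1)[symmetric] nth_map_upt) simp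
    then show ?thesis using that by (simp add: node_def len)
  qed
  have B: "gs k ! i \<in> blocks" if "i < k" for i k
    using branch_blocks[OF gs(2)[of k]] nth_mem[of i "gs k"] that len by auto
  define p where "p i = lab (gs (Suc i) ! i)" for i
  have p: "lab (gs k ! i) = p i" if "i < k" for i k
  proof -
    \<comment> \<open>The lists \<open>gs k\<close> are chosen separately for each k, so they are
      compared through their vectors: by injectivity of \<iota> equal vectors have equal supports,
      hence equal labels.\<close>
    have "unit_avg (gs k ! i) = unit_avg (gs (Suc i) ! i)"
      using nth[of i k] nth[of i "Suc i"] that
      by (intro \<iota>_inject unit_avg_in_c00 B) auto
    then show ?thesis
      using supp_unit_avg[OF B[OF that]] supp_unit_avg[OF B[OF lessI]] by (simp add: p_def lab_def)
  qed
  have "p i < p (Suc i)" for i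
  proof -
    have "sorted_wrt (<) (map lab (gs (Suc (Suc i))))"
      using gs(2) by (rule branch_lab_sorted)
    then have "lab (gs (Suc (Suc i)) ! i) < lab (gs (Suc (Suc i)) ! Suc i)"
      by (auto simp: sorted_wrt_iff_nth_less len)
    then show ?thesis by (simp add: p)
  qed
  then have "strict_mono p" by (simp add: strict_mono_Suc_iff)
  moreover have "p ` {..<k} = lab ` set (gs k)" for k
  proof -
    have "set (gs k) = (\<lambda>i. gs k ! i) ` {..<k}" by (auto simp: set_conv_nth len)
    then show ?thesis by (simp add: image_image p cong: image_cong_simp)
  qed
  ultimately show False using chain gs(3) by metis
qed

end

theorem proposition5p8:
  fixes \<xi> :: ordw1
    and seq :: "ordw1 \<Rightarrow> nat \<Rightarrow> ordw1"
    and M1 M2 M :: "nat set"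
    and \<sigma> :: "(nat \<Rightarrow> real) list \<Rightarrow> nat"
    and \<iota> :: "(nat \<Rightarrow> real) \<Rightarrow> 'a::banach"
  assumes "\<xi> < top"
    and "fundamental_sequences seq"
    and "coding M1 M2 \<sigma>"
    and "is_completion (G_norm (G_set (schreier seq \<xi>) M1 \<sigma>)) \<iota>"
    and "M \<subseteq> {1..}" and "infinite M"
  shows "bourgain_l1_index (closure (span {\<iota> (unit_vec n) | n. n \<in> M})) > ord_power ord_omega \<xi>"
proof -
  interpret coded_completion M1 M2 M \<sigma> "schreier seq \<xi>" \<iota>
    using assms(3-6) by unfold_locales
  let ?Y = "closure (span {\<iota> (unit_vec n) | n. n \<in> M})"
  have l1: "is_l1_tree 17 ?Y avg_tree"
    using schreier_hereditary[OF assms(1,2)] by (rule is_l1_tree_avg_tree)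
  then have tree: "is_tree avg_tree" by (simp add: is_l1_tree_def)
  have wf: "well_founded_tree avg_tree"
    using schreier_no_chain[OF assms(1,2)] by (rule well_founded_avg_tree)
  \<comment> \<open>The root, which is the node of the empty branch, survives to the derivative at
    \<open>ord_power ord_omega \<xi>\<close>. That derivative being nonempty, the order is strictly
    larger.\<close>
  have "\<iota> (unit_vec start) # map (\<lambda>g. \<iota> (unit_avg g)) [] \<in>
      tree_deriv avg_tree (ord_power ord_omega \<xi>)"
  proof (rule node_in_tree_deriv[where V = "Collect branch" and N = 0, OF assms(1,2) _ _ tree])
    show "\<exists>g. gs @ [g] \<in> Collect branch \<and> N \<le> lab g" if "gs \<in> Collect branch" for gs N
      using branch_extend that by simp
    show "sorted_wrt (<) (map lab gs)" if "gs \<in> Collect branch" for gs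
      using that branch_lab_sorted by simp
    show "[] \<in> Collect branch" by (simp add: branch.Nil)
    show "\<iota> (unit_vec start) # map (\<lambda>g. \<iota> (unit_avg g)) ([] @ hs) \<in> avg_tree"
      if "[] @ hs \<in> Collect branch" "lab ` set hs \<in> schreier seq \<xi>" for hs
      using that unfolding avg_tree_def node_def by auto
  qed
  then have "ord_power ord_omega \<xi> < tree_order avg_tree"
    using tree ord_power_omega_less_top[OF assms(1)] by (intro less_tree_order) auto
  also have "tree_order avg_tree \<le> bourgain_l1_index ?Y"
    unfolding bourgain_l1_index_def using l1 wf
    by (intro SUP_upper CollectI conjI exI[of _ 17]) auto
  finally show ?thesis .
qed

end
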